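(* Let $\mathcal{A}$ be an abelian von Neumann subalgebra of a type ${\rm II}_1$ factor $\mathcal{M}$ with normalized trace $\mathrm{tr}$, and suppose that there is a $*$-isomorphism $\pi\colon \mathcal{A}\to L^\infty[0,1]$ which induces an isometry from $L^2(\mathcal{A},\mathrm{tr})$ onto $L^2[0,1]$. Let $\{v_n : n\ge 0\}$, with $v_n\in\mathcal{A}$ for all $n$, be an orthonormal basis for $L^2(\mathcal{A},\mathrm{tr})$, and let $Y\subseteq\mathcal{M}$ be a set whose linear span is norm dense in $L^2(\mathcal{M},\mathrm{tr})$. If $$\sum_{n=0}^\infty \|\mathbb{E}_{\mathcal{A}}(xv_ny)-\mathbb{E}_{\mathcal{A}}(x)\,\mathbb{E}_{\mathcal{A}}(y)\,v_n\|_2^2<\infty$$ for all $x,y\in Y$, then $\mathbb{E}_{\mathcal{A}}$ is an asymptotic homomorphism, $\mathcal{A}$ is a strongly singular masa in $\mathcal{M}$, and $\delta(\mathcal{A})=1$.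
   Context: For a type ${\rm II}_1$ factor $\mathcal{M}$ with normalized trace $\mathrm{tr}$, $\|\cdot\|$ is the operator norm and $\|x\|_2=(\mathrm{tr}(x^*x))^{1/2}$. For a von Neumann subalgebra $\mathcal{N}\subseteq\mathcal{M}$, $\mathbb{E}_{\mathcal{N}}$ is the trace preserving conditional expectation of $\mathcal{M}$ onto $\mathcal{N}$. For a linear map $\phi\colon\mathcal{M}\to\mathcal{M}$, $\|\phi\|_{\infty,2}$ is the norm of $\phi$ when the domain has the operator norm and the range has the $\|\cdot\|_2$-norm, i.e. $\|\phi\|_{\infty,2}=\sup\{\|\phi(x)\|_2 : \|x\|\le 1\}$. A masa is a maximal abelian self-adjoint subalgebra. Asymptotic homomorphism: for an abelian von Neumann subalgebra $\mathcal{A}\subseteq\mathcal{M}$, $\mathbb{E}_{\mathcal{A}}$ is an asymptotic homomorphism if there is a unitary $u\in\mathcal{A}$ such that $\lim_{|j|\to\infty}\|\mathbb{E}_{\mathcal{A}}(xu^jy)-\mathbb{E}_{\mathcal{A}}(x)\mathbb{E}_{\mathcal{A}}(y)u^j\|_2=0$ (over integers $j$) for all $x,y\in\mathcal{M}$. Strong singularity: a masa $\mathcal{A}\subseteq\mathcal{M}$ is strongly singular if $\|u-\mathbb{E}_{\mathcal{A}}(u)\|_2\le\|\mathbb{E}_{u\mathcal{A}u^*}-\mathbb{E}_{\mathcal{A}}\|_{\infty,2}$ for all unitaries $u\in\mathcal{M}$. Popa invariant equal to 1: a masa $\mathcal{A}\subseteq\mathcal{M}$ has $\delta(\mathcal{A})=1$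 if, for each partial isometry $v\in\mathcal{M}$ with $v^2=0$ and $vv^*,v^*v\in\mathcal{A}$, one has $\sup\{\|(I-\mathbb{E}_{\mathcal{A}})(x)\|_2 : x\in v\mathcal{A}v^*,\ \|x\|\le 1\}\ge\|vv^*\|_2$. *)

theory Defs
  imports "HOL-Analysis.Analysis"
begin

subsection \<open>Complex Hilbert spaces and their bounded operators\<close>

class scaleC =
  fixes scaleC :: "complex \<Rightarrow> 'a \<Rightarrow> 'a"  (infixr \<open>*\<^sub>C\<close> 75)

class complex_vector = real_vector + scaleC +
  assumes scaleC_add_right: "c *\<^sub>C (x + y) = c *\<^sub>C x + c *\<^sub>C y"
    and scaleC_add_left: "(c + d) *\<^sub>C x = c *\<^sub>C x + d *\<^sub>C x"
    and scaleC_scaleC: "c *\<^sub>C d *\<^sub>C x = (c * d) *\<^sub>C x"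
    and scaleC_of_real: "complex_of_real r *\<^sub>C x = r *\<^sub>R x"

global_interpretation complex_vector:
  vector_space "scaleC :: complex \<Rightarrow> 'a \<Rightarrow> 'a::complex_vector"
proof
  show "1 *\<^sub>C x = x" for x :: 'a
    using scaleC_of_real[of 1 x] by simp
qed (simp_all add: scaleC_add_right scaleC_add_left scaleC_scaleC)

text \<open>The inner product is linear in its first argument.\<close>

class complex_inner = complex_vector + real_normed_vector +
  fixes cinner :: "'a \<Rightarrow> 'a \<Rightarrow> complex"
  assumes cinner_commute: "cinner x y = cnj (cinner y x)"
    and cinner_add_left: "cinner (x + y) z = cinner x z + cinner y z"
    and cinner_scaleC_left: "cinner (c *\<^sub>C x) y = c * cinner x y"
    and cinner_self: "cinner x x = complex_of_real ((norm x)\<^sup>2)"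

class complex_hilbert = complex_inner + complete_space

lemma norm_scaleC: "norm (c *\<^sub>C x) = cmod c * norm (x::'a::complex_inner)"
proof -
  have "cinner (c *\<^sub>C x) (c *\<^sub>C x) = c * cnj c * cinner x x"
    by (subst cinner_scaleC_left, subst cinner_commute, subst cinner_scaleC_left)
      (simp add: cinner_self)
  then have "complex_of_real ((norm (c *\<^sub>C x))\<^sup>2) = complex_of_real ((cmod c * norm x)\<^sup>2)"
    by (simp add: cinner_self complex_norm_square[symmetric] power_mult_distrib)
  then have "(norm (c *\<^sub>C x))\<^sup>2 = (cmod c * norm x)\<^sup>2"
    using of_real_eq_iff by blast
  then show ?thesis
    by (simp add: power2_eq_iff_nonneg)
qed

lemma bounded_linear_scaleC: "bounded_linear (\<lambda>x::'a::complex_inner. c *\<^sub>C x)"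
proof (rule bounded_linear_intro[where K = "cmod c"])
  show "c *\<^sub>C (r *\<^sub>R x) = r *\<^sub>R (c *\<^sub>C x)" for r and x :: 'a
    by (simp add: scaleC_of_real[symmetric] scaleC_scaleC mult.commute)
qed (simp_all add: scaleC_add_right norm_scaleC)

instantiation blinfun :: (real_normed_vector, complex_inner) complex_vector
begin

lift_definition scaleC_blinfun :: "complex \<Rightarrow> 'a \<Rightarrow>\<^sub>L 'b \<Rightarrow> 'a \<Rightarrow>\<^sub>L 'b"
  is "\<lambda>c T x. c *\<^sub>C T x"
  by (rule bounded_linear_compose[OF bounded_linear_scaleC])

instance
  by standard
    (transfer; simp add: fun_eq_iff scaleC_add_right scaleC_add_left scaleC_scaleC scaleC_of_real)+

end

text \<open>The type \<open>'h \<Rightarrow>\<^sub>L 'h\<close> consists of the real-linear bounded operators; \<open>B(H)\<close> is the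
  subset of the complex-linear ones. The norm of \<open>'h \<Rightarrow>\<^sub>L 'h\<close> is the operator norm.\<close>

type_synonym 'h op = "'h \<Rightarrow>\<^sub>L 'h"

definition bounded_ops :: "'h::complex_hilbert op set" where
  "bounded_ops = {T :: 'h op. \<forall>c x. T (c *\<^sub>C x) = c *\<^sub>C T x}"

definition adj :: "'h::complex_hilbert op \<Rightarrow> 'h op" where
  "adj T = (THE S :: 'h op. \<forall>x y. cinner (T x) y = cinner x (S y))"

definition op_nonneg :: "'h::complex_hilbert op \<Rightarrow> bool" where
  "op_nonneg T \<longleftrightarrow> (\<forall>x. cinner (T x) x \<in> \<real>\<^sub>\<ge>\<^sub>0)"

definition op_le :: "'h::complex_hilbert op \<Rightarrow> 'h op \<Rightarrow> bool" where
  "op_le S T \<longleftrightarrow> op_nonneg (T - S)"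

subsection \<open>Von Neumann algebras, type II-1 factors, traces\<close>

definition commutant :: "'h::complex_hilbert op set \<Rightarrow> 'h op set" where
  "commutant S = {T \<in> bounded_ops. \<forall>X\<in>S. T o\<^sub>L X = X o\<^sub>L T}"

definition star_subalgebra :: "'h::complex_hilbert op set \<Rightarrow> 'h op set \<Rightarrow> bool" where
  "star_subalgebra B M \<longleftrightarrow>
     B \<subseteq> M \<and> complex_vector.subspace B \<and>
     (\<forall>x\<in>B. \<forall>y\<in>B. x o\<^sub>L y \<in> B) \<and> (\<forall>x\<in>B. adj x \<in> B)"

definition von_neumann_algebra :: "'h::complex_hilbert op set \<Rightarrow> bool" where
  "von_neumann_algebra M \<longleftrightarrow>
     star_subalgebra M bounded_ops \<and> commutant (commutant M) = M"

text \<open>The double commutant contains the identity operator, so all von Neumann subalgebras of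
  \<open>M\<close> share its unit.\<close>

definition von_neumann_subalgebra :: "'h::complex_hilbert op set \<Rightarrow> 'h op set \<Rightarrow> bool" where
  "von_neumann_subalgebra N M \<longleftrightarrow> von_neumann_algebra N \<and> N \<subseteq> M"

definition abelian :: "'h::complex_hilbert op set \<Rightarrow> bool" where
  "abelian B \<longleftrightarrow> (\<forall>x\<in>B. \<forall>y\<in>B. x o\<^sub>L y = y o\<^sub>L x)"

definition factor :: "'h::complex_hilbert op set \<Rightarrow> bool" where
  "factor M \<longleftrightarrow> von_neumann_algebra M \<and> id_blinfun \<noteq> (0 :: 'h op) \<and>
     M \<inter> commutant M = {c *\<^sub>C id_blinfun | c. True}"

definition projection :: "'h::complex_hilbert op \<Rightarrow> bool" where
  "projection p \<longleftrightarrow> p o\<^sub>L p = p \<and> adj p = p"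

definition finite_projection :: "'h::complex_hilbert op set \<Rightarrow> 'h op \<Rightarrow> bool" where
  "finite_projection M p \<longleftrightarrow> p \<in> M \<and> projection p \<and>
     (\<forall>v\<in>M. adj v o\<^sub>L v = p \<and> op_le (v o\<^sub>L adj v) p \<longrightarrow> v o\<^sub>L adj v = p)"

definition abelian_projection :: "'h::complex_hilbert op set \<Rightarrow> 'h op \<Rightarrow> bool" where
  "abelian_projection M p \<longleftrightarrow> p \<in> M \<and> projection p \<and> abelian {p o\<^sub>L x o\<^sub>L p | x. x \<in> M}"

definition type_II1_factor :: "'h::complex_hilbert op set \<Rightarrow> bool" where
  "type_II1_factor M \<longleftrightarrow> factor M \<and> finite_projection M id_blinfun \<and>
     (\<forall>p. abelian_projection M p \<longrightarrow> p = 0)"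

definition normal_on :: "'h::complex_hilbert op set \<Rightarrow> ('h op \<Rightarrow> complex) \<Rightarrow> bool" where
  "normal_on M tr \<longleftrightarrow>
     (\<forall>D s. D \<subseteq> M \<and> D \<noteq> {} \<and> (\<forall>x\<in>D. op_nonneg x) \<and>
        (\<forall>x\<in>D. \<forall>y\<in>D. \<exists>z\<in>D. op_le x z \<and> op_le y z) \<and>
        s \<in> M \<and> (\<forall>x\<in>D. op_le x s) \<and> (\<forall>t\<in>M. (\<forall>x\<in>D. op_le x t) \<longrightarrow> op_le s t)
        \<longrightarrow> Re (tr s) = (SUP x\<in>D. Re (tr x)))"

text \<open>On a type II-1 factor there is exactly one function on \<open>M\<close> satisfying the following
  conditions; the values outside \<open>M\<close> are irrelevant.\<close>

definition normalized_trace :: "'h::complex_hilbert op set \<Rightarrow> ('h op \<Rightarrow> complex) \<Rightarrow> bool" where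
  "normalized_trace M tr \<longleftrightarrow>
     (\<forall>x\<in>M. \<forall>y\<in>M. tr (x + y) = tr x + tr y) \<and>
     (\<forall>c. \<forall>x\<in>M. tr (c *\<^sub>C x) = c * tr x) \<and>
     (\<forall>x\<in>M. op_nonneg x \<longrightarrow> tr x \<in> \<real>\<^sub>\<ge>\<^sub>0) \<and>
     (\<forall>x\<in>M. op_nonneg x \<and> tr x = 0 \<longrightarrow> x = 0) \<and>
     (\<forall>x\<in>M. \<forall>y\<in>M. tr (x o\<^sub>L y) = tr (y o\<^sub>L x)) \<and>
     normal_on M tr \<and>
     tr id_blinfun = 1"

definition norm2 :: "('h::complex_hilbert op \<Rightarrow> complex) \<Rightarrow> 'h op \<Rightarrow> real" where
  "norm2 tr x = sqrt (Re (tr (adj x o\<^sub>L x)))"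

subsection \<open>Conditional expectations and properties of abelian subalgebras\<close>

definition is_cond_exp ::
  "'h::complex_hilbert op set \<Rightarrow> ('h op \<Rightarrow> complex) \<Rightarrow> 'h op set \<Rightarrow> ('h op \<Rightarrow> 'h op) \<Rightarrow> bool" where
  "is_cond_exp M tr N E \<longleftrightarrow>
     (\<forall>x\<in>M. E x \<in> N) \<and>
     (\<forall>x\<in>M. \<forall>y\<in>M. E (x + y) = E x + E y) \<and>
     (\<forall>c. \<forall>x\<in>M. E (c *\<^sub>C x) = c *\<^sub>C E x) \<and>
     (\<forall>x\<in>M. op_nonneg x \<longrightarrow> op_nonneg (E x)) \<and>
     (\<forall>a\<in>N. E a = a) \<and>
     (\<forall>a\<in>N. \<forall>b\<in>N. \<forall>x\<in>M. E (a o\<^sub>L x o\<^sub>L b) = a o\<^sub>L E x o\<^sub>L b) \<and>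
     (\<forall>x\<in>M. tr (E x) = tr x)"

text \<open>The conditions determine \<open>E\<close> on \<open>M\<close>; extensionality fixes it elsewhere.\<close>

definition cond_exp ::
  "'h::complex_hilbert op set \<Rightarrow> ('h op \<Rightarrow> complex) \<Rightarrow> 'h op set \<Rightarrow> 'h op \<Rightarrow> 'h op" where
  "cond_exp M tr N = (THE E. E \<in> extensional M \<and> is_cond_exp M tr N E)"

definition norm_inf2 ::
  "'h::complex_hilbert op set \<Rightarrow> ('h op \<Rightarrow> complex) \<Rightarrow> ('h op \<Rightarrow> 'h op) \<Rightarrow> real" where
  "norm_inf2 M tr \<phi> = (SUP x\<in>{x \<in> M. norm x \<le> 1}. norm2 tr (\<phi> x))"

definition unitary :: "'h::complex_hilbert op \<Rightarrow> bool" where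
  "unitary u \<longleftrightarrow> adj u o\<^sub>L u = id_blinfun \<and> u o\<^sub>L adj u = id_blinfun"

definition op_pow :: "'h::complex_hilbert op \<Rightarrow> nat \<Rightarrow> 'h op" where
  "op_pow u n = ((o\<^sub>L) u ^^ n) id_blinfun"

text \<open>Integer powers of a unitary, whose inverse is its adjoint.\<close>

definition unitary_pow :: "'h::complex_hilbert op \<Rightarrow> int \<Rightarrow> 'h op" where
  "unitary_pow u j = (if 0 \<le> j then op_pow u (nat j) else op_pow (adj u) (nat (- j)))"

definition asymptotic_homomorphism ::
  "'h::complex_hilbert op set \<Rightarrow> ('h op \<Rightarrow> complex) \<Rightarrow> 'h op set \<Rightarrow> bool" where
  "asymptotic_homomorphism M tr A \<longleftrightarrow>
     (let E = cond_exp M tr A in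
      \<exists>u\<in>A. unitary u \<and>
        (\<forall>x\<in>M. \<forall>y\<in>M.
          ((\<lambda>j. norm2 tr (E (x o\<^sub>L unitary_pow u j o\<^sub>L y) - (E x o\<^sub>L E y o\<^sub>L unitary_pow u j)))
             \<longlongrightarrow> 0) (filtercomap (\<lambda>j::int. \<bar>j\<bar>) at_top)))"

definition masa :: "'h::complex_hilbert op set \<Rightarrow> 'h op set \<Rightarrow> bool" where
  "masa M A \<longleftrightarrow> star_subalgebra A M \<and> abelian A \<and>
     (\<forall>B. star_subalgebra B M \<and> abelian B \<and> A \<subseteq> B \<longrightarrow> B = A)"

definition strongly_singular_masa ::
  "'h::complex_hilbert op set \<Rightarrow> ('h op \<Rightarrow> complex) \<Rightarrow> 'h op set \<Rightarrow> bool" where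
  "strongly_singular_masa M tr A \<longleftrightarrow> masa M A \<and>
     (\<forall>u\<in>M. unitary u \<longrightarrow>
        norm2 tr (u - cond_exp M tr A u)
          \<le> norm_inf2 M tr
              (\<lambda>x. cond_exp M tr {u o\<^sub>L a o\<^sub>L adj u | a. a \<in> A} x - cond_exp M tr A x))"

definition popa_delta_one ::
  "'h::complex_hilbert op set \<Rightarrow> ('h op \<Rightarrow> complex) \<Rightarrow> 'h op set \<Rightarrow> bool" where
  "popa_delta_one M tr A \<longleftrightarrow> masa M A \<and>
     (\<forall>v\<in>M. v o\<^sub>L adj v o\<^sub>L v = v \<and> v o\<^sub>L v = 0 \<and> v o\<^sub>L adj v \<in> A \<and> adj v o\<^sub>L v \<in> A \<longrightarrow>
        norm2 tr (v o\<^sub>L adj v)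
          \<le> (SUP x\<in>{v o\<^sub>L a o\<^sub>L adj v | a. a \<in> A} \<inter> {x. norm x \<le> 1}.
               norm2 tr (x - cond_exp M tr A x)))"

subsection \<open>The completion \<open>L\<^sup>2(N, tr)\<close>\<close>

definition L2_cauchy :: "'h::complex_hilbert op set \<Rightarrow> ('h op \<Rightarrow> complex) \<Rightarrow> (nat \<Rightarrow> 'h op) set" where
  "L2_cauchy N tr = {s. range s \<subseteq> N \<and>
     (\<forall>e>0. \<exists>k. \<forall>m\<ge>k. \<forall>n\<ge>k. norm2 tr (s m - s n) < e)}"

definition L2_rel ::
  "'h::complex_hilbert op set \<Rightarrow> ('h op \<Rightarrow> complex) \<Rightarrow> ((nat \<Rightarrow> 'h op) \<times> (nat \<Rightarrow> 'h op)) set" where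
  "L2_rel N tr = {(s, t) \<in> L2_cauchy N tr \<times> L2_cauchy N tr.
     (\<lambda>n. norm2 tr (s n - t n)) \<longlonglongrightarrow> 0}"

definition L2 :: "'h::complex_hilbert op set \<Rightarrow> ('h op \<Rightarrow> complex) \<Rightarrow> (nat \<Rightarrow> 'h op) set set" where
  "L2 N tr = L2_cauchy N tr // L2_rel N tr"

definition L2_dist ::
  "('h::complex_hilbert op \<Rightarrow> complex) \<Rightarrow> (nat \<Rightarrow> 'h op) set \<Rightarrow> (nat \<Rightarrow> 'h op) set \<Rightarrow> real" where
  "L2_dist tr \<xi> \<eta> = (THE r. \<forall>s\<in>\<xi>. \<forall>t\<in>\<eta>. (\<lambda>n. norm2 tr (s n - t n)) \<longlonglongrightarrow> r)"

definition L2_embed ::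
  "'h::complex_hilbert op set \<Rightarrow> ('h op \<Rightarrow> complex) \<Rightarrow> 'h op \<Rightarrow> (nat \<Rightarrow> 'h op) set" where
  "L2_embed N tr x = L2_rel N tr `` {\<lambda>_. x}"

definition L2_dense ::
  "'h::complex_hilbert op set \<Rightarrow> ('h op \<Rightarrow> complex) \<Rightarrow> 'h op set \<Rightarrow> bool" where
  "L2_dense N tr Z \<longleftrightarrow> Z \<subseteq> N \<and>
     (\<forall>\<xi>\<in>L2 N tr. \<forall>e>0. \<exists>z\<in>Z. L2_dist tr \<xi> (L2_embed N tr z) < e)"

text \<open>Here \<open>tr (adj (v n) o\<^sub>L v m)\<close> is the inner product of \<open>v m\<close> and \<open>v n\<close> in \<open>L\<^sup>2(N, tr)\<close>.\<close>

definition L2_orthonormal_basis ::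
  "'h::complex_hilbert op set \<Rightarrow> ('h op \<Rightarrow> complex) \<Rightarrow> (nat \<Rightarrow> 'h op) \<Rightarrow> bool" where
  "L2_orthonormal_basis N tr v \<longleftrightarrow> range v \<subseteq> N \<and>
     (\<forall>m n. tr (adj (v n) o\<^sub>L v m) = (if m = n then 1 else 0)) \<and>
     L2_dense N tr (complex_vector.span (range v))"

subsection \<open>\<open>L\<^sup>\<infinity>[0,1]\<close> and \<open>L\<^sup>2[0,1]\<close> as sets of almost-everywhere classes\<close>

abbreviation unit_interval :: "real measure" where
  "unit_interval \<equiv> lebesgue_on {0..1}"

definition ae_class :: "(real \<Rightarrow> complex) \<Rightarrow> (real \<Rightarrow> complex) set" where
  "ae_class f = {g \<in> borel_measurable unit_interval. AE t in unit_interval. f t = g t}"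

definition Linf_01 :: "(real \<Rightarrow> complex) set set" where
  "Linf_01 = {ae_class f | f. f \<in> borel_measurable unit_interval \<and>
     (\<exists>C. AE t in unit_interval. cmod (f t) \<le> C)}"

definition L2_01 :: "(real \<Rightarrow> complex) set set" where
  "L2_01 = {ae_class f | f. f \<in> borel_measurable unit_interval \<and>
     integrable unit_interval (\<lambda>t. (cmod (f t))\<^sup>2)}"

definition star_isomorphism_Linf ::
  "'h::complex_hilbert op set \<Rightarrow> ('h op \<Rightarrow> (real \<Rightarrow> complex) set) \<Rightarrow> bool" where
  "star_isomorphism_Linf A \<pi> \<longleftrightarrow> bij_betw \<pi> A Linf_01 \<and>
     (\<forall>a\<in>A. \<forall>b\<in>A. \<forall>f\<in>\<pi> a. \<forall>g\<in>\<pi> b. (\<lambda>t. f t + g t) \<in> \<pi> (a + b)) \<and>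
     (\<forall>a\<in>A. \<forall>b\<in>A. \<forall>f\<in>\<pi> a. \<forall>g\<in>\<pi> b. (\<lambda>t. f t * g t) \<in> \<pi> (a o\<^sub>L b)) \<and>
     (\<forall>c. \<forall>a\<in>A. \<forall>f\<in>\<pi> a. (\<lambda>t. c * f t) \<in> \<pi> (c *\<^sub>C a)) \<and>
     (\<forall>a\<in>A. \<forall>f\<in>\<pi> a. (\<lambda>t. cnj (f t)) \<in> \<pi> (adj a))"

text \<open>\<open>U\<close> extends \<open>\<pi>\<close> to the completions. Its linearity is not stated: it follows from that of
  \<open>\<pi>\<close> by density and continuity.\<close>

definition induces_L2_isometry ::
  "'h::complex_hilbert op set \<Rightarrow> ('h op \<Rightarrow> complex) \<Rightarrow> ('h op \<Rightarrow> (real \<Rightarrow> complex) set) \<Rightarrow> bool" where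
  "induces_L2_isometry A tr \<pi> \<longleftrightarrow>
     (\<exists>U. U ` L2 A tr = L2_01 \<and>
        (\<forall>\<xi>\<in>L2 A tr. \<forall>\<eta>\<in>L2 A tr. \<forall>f\<in>U \<xi>. \<forall>g\<in>U \<eta>.
           sqrt (LINT t|unit_interval. (cmod (f t - g t))\<^sup>2) = L2_dist tr \<xi> \<eta>) \<and>
        (\<forall>a\<in>A. U (L2_embed A tr a) = \<pi> a))"

end

theory Submission
  imports Defs
begin

text \<open>Write \<open>T\<^bsub>x,y\<^esub> a = E (x a y) - E x E y a\<close> for the defect of multiplicativity of the conditional
  expectation \<open>E\<close> onto \<open>A\<close>, a bounded operator on \<open>L\<^sup>2(A)\<close>. The hypothesis says that it is
  Hilbert--Schmidt for \<open>x, y \<in> Y\<close>, and a Hilbert--Schmidt operator sends every infinite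
  orthonormal family to a null family (\<open>hilbert_schmidt_tendsto_0\<close>), whichever orthonormal basis
  was used to test it. The identification of \<open>A\<close> with \<open>L\<^sup>\<infinity>[0,1]\<close> provides such a family
  consisting of powers of one unitary: the preimage \<open>u\<close> of \<open>e\<^bsup>2\<pi>it\<^esup>\<close> (\<open>haar_unitary\<close>). Hence
  \<open>T\<^bsub>x,y\<^esub> u\<^sup>j \<rightarrow> 0\<close> as \<open>\<bar>j\<bar> \<rightarrow> \<infinity>\<close> for \<open>x, y \<in> Y\<close>, and since the defect is bilinear in \<open>x\<close> and \<open>y\<close> and
  2-norm continuous in each of them uniformly in \<open>j\<close>, also for all \<open>x, y \<in> M\<close>
  (\<open>tendsto_0_of_dense\<close>). This is the asymptotic homomorphism property.

  The other conclusions follow from this property by inserting suitable \<open>x\<close> and \<open>y\<close>.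
  For \<open>b\<close> commuting with \<open>A\<close>, the choice \<open>x = b\<close>, \<open>y = b\<^sup>*\<close> gives \<open>E (b b\<^sup>*) = E b E (b\<^sup>*)\<close>, whence
  \<open>b = E b \<in> A\<close>, so \<open>A\<close> is a masa. For a unitary \<open>w\<close>, the elements \<open>w u\<^sup>j w\<^sup>*\<close> of \<open>w A w\<^sup>*\<close> have images
  under \<open>E\<close> whose 2-norm is at most that of \<open>E w\<close> in the limit, which gives strong singularity. For a
  nilpotent partial isometry \<open>v\<close> with range and initial projections in \<open>A\<close> one has \<open>E v = 0\<close>, so the
  elements \<open>v u\<^sup>j v\<^sup>*\<close> are asymptotically orthogonal to \<open>A\<close>, which gives \<open>\<delta>(A) = 1\<close>.

  Adjoints and conditional expectations are defined by descriptions, so their existence has to be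
  established. Adjoints come from the Riesz representation theorem (\<open>riesz_representation_Re\<close>).
  The expectation onto \<open>A\<close> sends \<open>x\<close> to the limit in \<open>L\<^sup>2[0,1]\<close> of its expansion in the given basis;
  this limit is an essentially bounded function because its average over a set \<open>S\<close> with projection
  \<open>p\<close> is \<open>tr (p x p) / tr p\<close> (\<open>ex_projection\<close>). The expectation onto \<open>w A w\<^sup>*\<close> is a conjugate of it.\<close>

section \<open>Complex inner products and adjoints\<close>

lemma cinner_add_right: "cinner x (y + z) = cinner x y + cinner x (z::'a::complex_inner)"
  by (metis cinner_add_left cinner_commute complex_cnj_add)

lemma cinner_scaleC_right: "cinner x (c *\<^sub>C y) = cnj c * cinner x (y::'a::complex_inner)"
  by (metis cinner_commute cinner_scaleC_left complex_cnj_mult)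

lemma cinner_zero_left [simp]: "cinner 0 (y::'a::complex_inner) = 0"
  using cinner_add_left[of 0 0 y] by simp

lemma cinner_zero_right [simp]: "cinner y (0::'a::complex_inner) = 0"
  using cinner_add_right[of y 0 0] by simp

lemma cinner_minus_left: "cinner (- x) y = - cinner x (y::'a::complex_inner)"
  using cinner_add_left[of x "- x" y] by (simp add: eq_neg_iff_add_eq_0 add.commute)

lemma cinner_minus_right: "cinner x (- y) = - cinner x (y::'a::complex_inner)"
  using cinner_add_right[of x y "- y"] by (simp add: eq_neg_iff_add_eq_0 add.commute)

lemma cinner_diff_left: "cinner (x - y) z = cinner x z - cinner y (z::'a::complex_inner)"
  using cinner_add_left[of x "- y" z] by (simp add: cinner_minus_left)

lemma cinner_diff_right: "cinner z (x - y) = cinner z x - cinner z (y::'a::complex_inner)"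
  using cinner_add_right[of z x "- y"] by (simp add: cinner_minus_right)

lemma cinner_scaleR_left: "cinner (r *\<^sub>R x) y = r * cinner x (y::'a::complex_inner)"
  using cinner_scaleC_left[of "complex_of_real r"] by (simp add: scaleC_of_real)

lemma cinner_scaleR_right: "cinner x (r *\<^sub>R y) = r * cinner x (y::'a::complex_inner)"
  using cinner_scaleC_right[of x "complex_of_real r"] by (simp add: scaleC_of_real)

lemma norm_power2_eq_cinner: "(norm (x::'a::complex_inner))\<^sup>2 = Re (cinner x x)"
  by (simp add: cinner_self)

lemma Re_cinner_commute: "Re (cinner x y) = Re (cinner y (x::'a::complex_inner))"
  by (subst cinner_commute) simp

lemma norm_add_power2:
  "(norm (x + y::'a::complex_inner))\<^sup>2 = (norm x)\<^sup>2 + 2 * Re (cinner x y) + (norm y)\<^sup>2"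
  by (simp add: norm_power2_eq_cinner cinner_add_left cinner_add_right Re_cinner_commute[of y x])

lemma norm_diff_power2:
  "(norm (x - y::'a::complex_inner))\<^sup>2 = (norm x)\<^sup>2 - 2 * Re (cinner x y) + (norm y)\<^sup>2"
  by (simp add: norm_power2_eq_cinner cinner_diff_left cinner_diff_right Re_cinner_commute[of y x])

lemma Re_of_real_mult: "Re (complex_of_real r * z) = r * Re z"
  by simp

text \<open>After rescaling to unit vectors this is the expansion of \<open>\<parallel>x - y\<parallel>\<^sup>2 \<ge> 0\<close>.\<close>

lemma Re_cinner_le: "Re (cinner x y) \<le> norm x * norm (y::'a::complex_inner)"
proof (cases "x = 0 \<or> y = 0")
  case False
  define x' where "x' = inverse (norm x) *\<^sub>R x"
  define y' where "y' = inverse (norm y) *\<^sub>R y"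
  have n: "norm x' = 1" "norm y' = 1"
    using False by (simp_all add: x'_def y'_def)
  have "0 \<le> (norm (x' - y'))\<^sup>2" by simp
  then have "Re (cinner x' y') \<le> 1"
    unfolding norm_diff_power2 n by simp
  moreover have "Re (cinner x' y') = inverse (norm x) * inverse (norm y) * Re (cinner x y)"
    by (simp only: x'_def y'_def cinner_scaleR_left cinner_scaleR_right Re_of_real_mult)
      (simp only: mult.assoc mult.left_commute)
  ultimately show ?thesis
    using False by (simp add: field_simps)
qed auto

lemma bounded_linear_Re_cinner_left: "bounded_linear (\<lambda>x::'a::complex_inner. Re (cinner x y))"
proof (rule bounded_linear_intro[where K = "norm y"])
  fix x :: 'a
  have "- Re (cinner x y) \<le> norm x * norm y"
    using Re_cinner_le[of "- x" y] by (simp add: cinner_minus_left)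
  then show "norm (Re (cinner x y)) \<le> norm x * norm y"
    using Re_cinner_le[of x y] by (simp add: abs_le_iff)
qed (simp_all add: cinner_add_left cinner_scaleR_left)

lemma cinner_left_eqI:
  assumes "\<And>x. cinner x y = cinner x (z::'a::complex_inner)"
  shows "y = z"
proof -
  have "cinner (y - z) (y - z) = 0"
    using assms by (simp add: cinner_diff_right)
  then show ?thesis
    by (simp add: cinner_self)
qed

text \<open>The representing vector is the minimiser of \<open>\<parallel>x\<parallel>\<^sup>2 - 2 f x\<close>. By the parallelogram law a
  minimising sequence is Cauchy, so completeness provides the minimiser; that the derivative
  of the functional vanishes there is the representation formula.\<close>

lemma riesz_representation_Re:
  fixes f :: "'a::complex_hilbert \<Rightarrow> real"
  assumes f: "bounded_linear f"
  shows "\<exists>z. \<forall>x. f x = Re (cinner x z)"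
proof -
  interpret f: bounded_linear f by (rule f)
  obtain K where K: "\<And>x. norm (f x) \<le> norm x * K"
    using f.bounded by blast
  define J where "J x = (norm x)\<^sup>2 - 2 * f x" for x
  have J_ge: "J x \<ge> - K\<^sup>2" for x
  proof -
    have "2 * f x \<le> 2 * (norm x * K)"
      using K[of x] by simp
    moreover have "0 \<le> (norm x - K)\<^sup>2" by simp
    ultimately show ?thesis
      unfolding J_def power2_diff by (simp add: power2_eq_square)
  qed
  define m where "m = (INF x. J x)"
  have bdd: "bdd_below (range J)"
    using J_ge by (auto intro!: bdd_belowI)
  have m_le: "m \<le> J x" for x
    unfolding m_def by (rule cINF_lower[OF bdd]) simp
  have "\<exists>x. J x < m + inverse (real (Suc n))" for n
  proof -
    have "m < m + inverse (real (Suc n))" by simp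
    then show ?thesis
      using cINF_less_iff[OF _ bdd, of "m + inverse (real (Suc n))"] unfolding m_def by blast
  qed
  then obtain X where X: "\<And>n. J (X n) < m + inverse (real (Suc n))"
    by metis
  \<comment> \<open>The parallelogram law, with \<open>J\<close> bounded below by \<open>m\<close> at the midpoint of \<open>x\<close> and \<open>y\<close>.\<close>
  have par: "(norm (x - y))\<^sup>2 \<le> 2 * (J x - m) + 2 * (J y - m)" for x y
  proof -
    have "4 * m \<le> 4 * J ((1/2) *\<^sub>R (x + y))"
      using m_le by simp
    also have "\<dots> = (norm (x + y))\<^sup>2 - 4 * (f x + f y)"
      by (simp only: J_def norm_scaleR f.scaleR f.add)
        (simp add: power_mult_distrib power2_eq_square field_simps)
    finally show ?thesis
      using norm_add_power2[of x y] norm_diff_power2[of x y] by (simp add: J_def)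
  qed
  have "Cauchy X"
  proof (rule CauchyI)
    fix e :: real
    assume e: "0 < e"
    then obtain N where N: "inverse (real (Suc N)) < e\<^sup>2 / 4"
      using reals_Archimedean[of "e\<^sup>2 / 4"] by auto
    show "\<exists>N. \<forall>m\<ge>N. \<forall>n\<ge>N. norm (X m - X n) < e"
    proof (intro exI allI impI)
      fix p q
      assume pq: "N \<le> p" "N \<le> q"
      have J_less: "J (X n) < m + e\<^sup>2 / 4" if "N \<le> n" for n
      proof -
        have "inverse (real (Suc n)) \<le> inverse (real (Suc N))"
          using that by (simp add: field_simps)
        also note N
        finally show ?thesis
          using X[of n] by simp
      qed
      have "(norm (X p - X q))\<^sup>2 < e\<^sup>2"
        using par[of "X p" "X q"] J_less[OF pq(1)] J_less[OF pq(2)] by (simp add: field_simps)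
      then show "norm (X p - X q) < e"
        using e by (simp add: power_less_imp_less_base)
    qed
  qed
  then obtain z where z: "X \<longlonglongrightarrow> z"
    using Cauchy_convergent convergent_def by blast
  have "(\<lambda>n. J (X n)) \<longlonglongrightarrow> J z"
    unfolding J_def by (intro tendsto_intros z f.tendsto)
  moreover have "(\<lambda>n. m + inverse (real (Suc n))) \<longlonglongrightarrow> m + 0"
    by (intro tendsto_intros LIMSEQ_inverse_real_of_nat)
  ultimately have "J z \<le> m + 0"
    using X by (intro LIMSEQ_le) (auto intro: less_imp_le)
  then have Jz: "J z \<le> J x" for x
    using m_le[of x] by simp
  have "f x = Re (cinner x z)" for x
  proof -
    define d where "d = Re (cinner x z) - f x"
    have quad: "0 \<le> 2 * t * d + t\<^sup>2 * (norm x)\<^sup>2" for t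
      using Jz[of "z + t *\<^sub>R x"]
      by (simp add: J_def norm_add_power2 f.add f.scaleR d_def cinner_scaleR_right
          Re_cinner_commute[of z x] power_mult_distrib algebra_simps)
    have "d = 0"
    proof (rule ccontr)
      assume "d \<noteq> 0"
      \<comment> \<open>The minimiser of the quadratic is \<open>- d / \<parallel>x\<parallel>\<^sup>2\<close>; adding 1 covers \<open>x = 0\<close>.\<close>
      define t where "t = - d / ((norm x)\<^sup>2 + 1)"
      have p: "(norm x)\<^sup>2 + 1 > 0" by (simp add: add_nonneg_pos)
      have "2 * t * d + t\<^sup>2 * (norm x)\<^sup>2 = (d / ((norm x)\<^sup>2 + 1))\<^sup>2 * (- (norm x)\<^sup>2 - 2)"
        using p by (simp add: t_def power2_eq_square divide_simps) (simp add: algebra_simps)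
      moreover have "\<dots> < 0"
        using p \<open>d \<noteq> 0\<close> by (intro mult_pos_neg) (auto simp: field_simps)
      ultimately show False
        using quad[of t] by simp
    qed
    then show ?thesis by (simp add: d_def)
  qed
  then show ?thesis by blast
qed

lemma bounded_ops_scaleC: "T \<in> bounded_ops \<Longrightarrow> T (c *\<^sub>C x) = c *\<^sub>C T x"
  by (simp add: bounded_ops_def)

text \<open>The Riesz vector of \<open>x \<mapsto> Re \<langle>T x, y\<rangle>\<close> also represents the imaginary part, because replacing
  \<open>x\<close> by \<open>\<i> x\<close> exchanges the two parts up to sign and \<open>T\<close> is complex-linear.\<close>

lemma ex_adjoint:
  fixes T :: "'h::complex_hilbert op"
  assumes T: "T \<in> bounded_ops"
  shows "\<exists>S. \<forall>x y. cinner (T x) y = cinner x (blinfun_apply S y)"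
proof -
  have "\<exists>z. \<forall>x. Re (cinner (T x) y) = Re (cinner x z)" for y
    using bounded_linear_compose[OF bounded_linear_Re_cinner_left[of y] blinfun.bounded_linear_right]
    by (rule riesz_representation_Re)
  then obtain S where S: "\<And>x y. Re (cinner (T x) y) = Re (cinner x (S y))"
    by metis
  have adj: "cinner (T x) y = cinner x (S y)" for x y
  proof (rule complex_eqI)
    have "Re (cinner (T (\<i> *\<^sub>C x)) y) = Re (cinner (\<i> *\<^sub>C x) (S y))"
      by (rule S)
    then show "Im (cinner (T x) y) = Im (cinner x (S y))"
      by (simp add: bounded_ops_scaleC[OF T] cinner_scaleC_left)
  qed (rule S)
  have "bounded_linear S"
  proof (rule bounded_linear_intro[where K = "norm T"])
    show "S (x + y) = S x + S y" for x y
      by (rule cinner_left_eqI) (simp add: adj[symmetric] cinner_add_right)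
    show "S (r *\<^sub>R x) = r *\<^sub>R S x" for r x
      by (rule cinner_left_eqI) (simp add: adj[symmetric] cinner_scaleR_right)
    show "norm (S y) \<le> norm y * norm T" for y
    proof (cases "S y = 0")
      case False
      have "(norm (S y))\<^sup>2 = Re (cinner (T (S y)) y)"
        by (simp add: norm_power2_eq_cinner adj)
      also have "\<dots> \<le> norm (T (S y)) * norm y"
        by (rule Re_cinner_le)
      also have "\<dots> \<le> norm T * norm (S y) * norm y"
        by (intro mult_right_mono norm_blinfun) simp
      finally show ?thesis
        using False by (simp add: power2_eq_square field_simps)
    qed simp
  qed
  then show ?thesis
    using adj by (intro exI[of _ "Blinfun S"]) (simp add: bounded_linear_Blinfun_apply)
qed

lemma adj_unique:
  assumes "\<And>x y. cinner (blinfun_apply T x) y = cinner x (blinfun_apply S y)"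
  shows "adj T = S"
  unfolding adj_def
proof (rule the_equality)
  show "S' = S" if "\<forall>x y. cinner (T x) y = cinner x (blinfun_apply S' y)" for S'
    using that assms by (intro blinfun_eqI cinner_left_eqI) metis
qed (use assms in blast)

lemma cinner_adj_right:
  assumes "T \<in> bounded_ops"
  shows "cinner x (adj T y) = cinner (T x) y"
  using ex_adjoint[OF assms] adj_unique by metis

lemma cinner_adj_left:
  assumes "T \<in> bounded_ops"
  shows "cinner (adj T x) y = cinner x (T y)"
  by (metis assms cinner_adj_right cinner_commute)

section \<open>The algebra of bounded operators\<close>

lemma bounded_ops_id: "id_blinfun \<in> bounded_ops"
  by (simp add: bounded_ops_def)

lemma blinfun_apply_scaleC [simp]: "blinfun_apply (c *\<^sub>C T) x = c *\<^sub>C blinfun_apply T x"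
  by transfer simp

lemma adj_adj: "T \<in> bounded_ops \<Longrightarrow> adj (adj T) = T"
  by (rule adj_unique) (rule cinner_adj_left)

lemma adj_compose: "S \<in> bounded_ops \<Longrightarrow> T \<in> bounded_ops \<Longrightarrow> adj (S o\<^sub>L T) = adj T o\<^sub>L adj S"
  by (rule adj_unique) (simp add: cinner_adj_right)

lemma adj_add: "S \<in> bounded_ops \<Longrightarrow> T \<in> bounded_ops \<Longrightarrow> adj (S + T) = adj S + adj T"
  by (rule adj_unique)
    (simp add: blinfun.add_left cinner_add_left cinner_add_right cinner_adj_right)

lemma adj_scaleC: "T \<in> bounded_ops \<Longrightarrow> adj (c *\<^sub>C T) = cnj c *\<^sub>C adj T"
  by (rule adj_unique) (simp add: cinner_scaleC_left cinner_scaleC_right cinner_adj_right)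

lemma adj_id [simp]: "adj id_blinfun = id_blinfun"
  by (rule adj_unique) simp

lemma compose_scaleC_left [simp]: "(c *\<^sub>C S) o\<^sub>L T = c *\<^sub>C (S o\<^sub>L T)"
  by (rule blinfun_eqI) simp

lemma compose_scaleC_right: "S \<in> bounded_ops \<Longrightarrow> S o\<^sub>L (c *\<^sub>C T) = c *\<^sub>C (S o\<^sub>L T)"
  by (rule blinfun_eqI) (simp add: bounded_ops_scaleC)

lemma compose_assoc: "(R o\<^sub>L S) o\<^sub>L T = R o\<^sub>L (S o\<^sub>L T)"
  by (rule blinfun_eqI) simp

lemma compose_id [simp]: "id_blinfun o\<^sub>L T = T" "T o\<^sub>L id_blinfun = T"
  by (rule blinfun_eqI, simp)+

lemma scaleC_minus1: "(- 1) *\<^sub>C x = - (x::'a::complex_vector)"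
  using complex_vector.scale_minus_left[of 1 x] by simp

lemma op_nonneg_adj_compose:
  assumes "T \<in> bounded_ops"
  shows "op_nonneg (adj T o\<^sub>L T)"
  unfolding op_nonneg_def by (simp add: cinner_adj_left[OF assms] cinner_self)

lemma op_nonneg_sandwich:
  assumes "T \<in> bounded_ops" "op_nonneg P"
  shows "op_nonneg (adj T o\<^sub>L P o\<^sub>L T)"
  using assms unfolding op_nonneg_def by (simp add: cinner_adj_left)

lemma op_nonneg_norm_le:
  assumes "T \<in> bounded_ops" "norm T \<le> c"
  shows "op_nonneg ((complex_of_real (c\<^sup>2)) *\<^sub>C id_blinfun - (adj T o\<^sub>L T))"
  unfolding op_nonneg_def
proof
  fix x
  have "norm (T x) \<le> c * norm x"
    using norm_blinfun[of T x] mult_right_mono[OF assms(2) norm_ge_zero] by (rule order_trans)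
  from power_mono[OF this norm_ge_zero, of 2]
  have "(norm (T x))\<^sup>2 \<le> c\<^sup>2 * (norm x)\<^sup>2"
    by (simp only: power_mult_distrib)
  moreover have "cinner ((complex_of_real (c\<^sup>2) *\<^sub>C id_blinfun - (adj T o\<^sub>L T)) x) x
      = complex_of_real (c\<^sup>2 * (norm x)\<^sup>2 - (norm (T x))\<^sup>2)"
    by (simp add: blinfun.diff_left cinner_diff_left cinner_scaleC_left
        cinner_adj_left[OF assms(1)] cinner_self)
  ultimately show "cinner ((complex_of_real (c\<^sup>2) *\<^sub>C id_blinfun - (adj T o\<^sub>L T)) x) x \<in> \<real>\<^sub>\<ge>\<^sub>0"
    by (simp only: nonneg_Reals_of_real_iff diff_ge_0_iff_ge)
qed

lemma norm_le_1I:
  assumes "T \<in> bounded_ops" "op_nonneg (id_blinfun - (adj T o\<^sub>L T))"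
  shows "norm T \<le> 1"
proof (rule norm_blinfun_bound)
  fix x
  have "cinner ((id_blinfun - (adj T o\<^sub>L T)) x) x = complex_of_real ((norm x)\<^sup>2 - (norm (T x))\<^sup>2)"
    by (simp add: blinfun.diff_left cinner_diff_left cinner_adj_left[OF assms(1)] cinner_self)
  moreover have "cinner ((id_blinfun - (adj T o\<^sub>L T)) x) x \<in> \<real>\<^sub>\<ge>\<^sub>0"
    using assms(2) by (simp add: op_nonneg_def)
  ultimately have "(norm (T x))\<^sup>2 \<le> (norm x)\<^sup>2"
    by (simp only: nonneg_Reals_of_real_iff diff_ge_0_iff_ge)
  then show "norm (T x) \<le> 1 * norm x"
    using power2_le_imp_le by auto
qed simp

lemma norm_adj_le:
  assumes "T \<in> bounded_ops"
  shows "norm (adj T) \<le> norm T"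
proof (rule norm_blinfun_bound)
  fix y
  show "norm (adj T y) \<le> norm T * norm y"
  proof (cases "adj T y = 0")
    case False
    have "(norm (adj T y))\<^sup>2 = Re (cinner (T (adj T y)) y)"
      by (simp add: norm_power2_eq_cinner cinner_adj_right[OF assms])
    also have "\<dots> \<le> norm (T (adj T y)) * norm y"
      by (rule Re_cinner_le)
    also have "\<dots> \<le> norm T * norm (adj T y) * norm y"
      by (intro mult_right_mono norm_blinfun) simp
    finally show ?thesis
      using False by (simp add: power2_eq_square field_simps)
  qed simp
qed simp

lemma unitary_norm_le_1:
  assumes "u \<in> bounded_ops" "unitary u"
  shows "norm u \<le> 1"
  using assms by (intro norm_le_1I) (simp_all add: unitary_def op_nonneg_def blinfun.zero_left)

lemma compose_add_left: "(R + S) o\<^sub>L T = (R o\<^sub>L T) + (S o\<^sub>L T)"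
  by (rule blinfun_eqI) (simp add: blinfun.add_left)

lemma compose_add_right: "R o\<^sub>L (S + T) = (R o\<^sub>L S) + (R o\<^sub>L T)"
  by (rule blinfun_eqI) (simp add: blinfun.add_left blinfun.add_right)

lemma compose_diff_left: "(R - S) o\<^sub>L T = (R o\<^sub>L T) - (S o\<^sub>L T)"
  by (rule blinfun_eqI) (simp add: blinfun.diff_left)

lemma compose_diff_right: "R o\<^sub>L (S - T) = (R o\<^sub>L S) - (R o\<^sub>L T)"
  by (rule blinfun_eqI) (simp add: blinfun.diff_left blinfun.diff_right)

lemma star_subalgebra_in: "star_subalgebra N M \<Longrightarrow> x \<in> N \<Longrightarrow> x \<in> M"
  by (auto simp: star_subalgebra_def)

lemma star_subalgebra_subspace: "star_subalgebra N M \<Longrightarrow> complex_vector.subspace N"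
  by (simp add: star_subalgebra_def)

lemmas star_subalgebra_add = complex_vector.subspace_add[OF star_subalgebra_subspace]
lemmas star_subalgebra_diff = complex_vector.subspace_diff[OF star_subalgebra_subspace]
lemmas star_subalgebra_scaleC = complex_vector.subspace_scale[OF star_subalgebra_subspace]
lemmas star_subalgebra_zero = complex_vector.subspace_0[OF star_subalgebra_subspace]
lemmas star_subalgebra_sum = complex_vector.subspace_sum[OF star_subalgebra_subspace]

lemma star_subalgebra_compose: "star_subalgebra N M \<Longrightarrow> x \<in> N \<Longrightarrow> y \<in> N \<Longrightarrow> x o\<^sub>L y \<in> N"
  by (simp add: star_subalgebra_def)

lemma star_subalgebra_adj: "star_subalgebra N M \<Longrightarrow> x \<in> N \<Longrightarrow> adj x \<in> N"
  by (simp add: star_subalgebra_def)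

lemma von_neumann_algebra_id: "von_neumann_algebra M \<Longrightarrow> id_blinfun \<in> M"
proof -
  assume "von_neumann_algebra M"
  then have "M = commutant (commutant M)"
    by (simp add: von_neumann_algebra_def)
  moreover have "id_blinfun \<in> commutant (commutant M)"
    by (simp add: commutant_def bounded_ops_id)
  ultimately show ?thesis by metis
qed

section \<open>The trace inner product\<close>

locale traced_algebra =
  fixes M :: "'h::complex_hilbert op set" and tr :: "'h op \<Rightarrow> complex"
  assumes star: "star_subalgebra M bounded_ops"
    and id_in [simp, intro]: "id_blinfun \<in> M"
    and trace: "normalized_trace M tr"
begin

lemma bounded_op: "x \<in> M \<Longrightarrow> x \<in> bounded_ops"
  by (rule star_subalgebra_in[OF star])

lemma closed [simp, intro]:
  shows "x \<in> M \<Longrightarrow> y \<in> M \<Longrightarrow> x + y \<in> M"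
    and "x \<in> M \<Longrightarrow> y \<in> M \<Longrightarrow> x - y \<in> M"
    and "x \<in> M \<Longrightarrow> y \<in> M \<Longrightarrow> x o\<^sub>L y \<in> M"
    and "x \<in> M \<Longrightarrow> c *\<^sub>C x \<in> M"
    and "x \<in> M \<Longrightarrow> adj x \<in> M"
    and "0 \<in> M"
  using star_subalgebra_add[OF star] star_subalgebra_diff[OF star] star_subalgebra_scaleC[OF star]
    star_subalgebra_zero[OF star] star_subalgebra_compose[OF star] star_subalgebra_adj[OF star]
  by auto

lemma sum_closed [simp, intro]: "(\<And>i. i \<in> I \<Longrightarrow> f i \<in> M) \<Longrightarrow> sum f I \<in> M"
  by (rule star_subalgebra_sum[OF star])

lemma adj_simps [simp]:
  shows "x \<in> M \<Longrightarrow> adj (adj x) = x"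
    and "x \<in> M \<Longrightarrow> y \<in> M \<Longrightarrow> adj (x o\<^sub>L y) = adj y o\<^sub>L adj x"
    and "x \<in> M \<Longrightarrow> y \<in> M \<Longrightarrow> adj (x + y) = adj x + adj y"
    and "x \<in> M \<Longrightarrow> adj (c *\<^sub>C x) = cnj c *\<^sub>C adj x"
  by (simp_all add: bounded_op adj_adj adj_compose adj_add adj_scaleC)

lemma adj_diff [simp]: "x \<in> M \<Longrightarrow> y \<in> M \<Longrightarrow> adj (x - y) = adj x - adj y"
  using adj_simps(3)[of "x - y" y] by (simp add: algebra_simps)

lemma compose_scaleC_right' [simp]: "x \<in> M \<Longrightarrow> x o\<^sub>L (c *\<^sub>C y) = c *\<^sub>C (x o\<^sub>L y)"
  by (simp add: compose_scaleC_right bounded_op)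

lemma
  shows tr_add: "x \<in> M \<Longrightarrow> y \<in> M \<Longrightarrow> tr (x + y) = tr x + tr y"
    and tr_scaleC: "x \<in> M \<Longrightarrow> tr (c *\<^sub>C x) = c * tr x"
    and tr_nonneg: "x \<in> M \<Longrightarrow> op_nonneg x \<Longrightarrow> tr x \<in> \<real>\<^sub>\<ge>\<^sub>0"
    and tr_faithful: "x \<in> M \<Longrightarrow> op_nonneg x \<Longrightarrow> tr x = 0 \<Longrightarrow> x = 0"
    and tr_commute: "x \<in> M \<Longrightarrow> y \<in> M \<Longrightarrow> tr (x o\<^sub>L y) = tr (y o\<^sub>L x)"
    and tr_id: "tr id_blinfun = 1"
  using trace by (simp_all add: normalized_trace_def)

lemma tr_diff: "x \<in> M \<Longrightarrow> y \<in> M \<Longrightarrow> tr (x - y) = tr x - tr y"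
  using tr_add[of "x - y" y] by simp

definition ip :: "'h op \<Rightarrow> 'h op \<Rightarrow> complex" where
  "ip x y = tr (adj y o\<^sub>L x)"

lemma ip_add_left: "x \<in> M \<Longrightarrow> y \<in> M \<Longrightarrow> z \<in> M \<Longrightarrow> ip (x + y) z = ip x z + ip y z"
  by (simp add: ip_def compose_add_right tr_add)

lemma ip_add_right: "x \<in> M \<Longrightarrow> y \<in> M \<Longrightarrow> z \<in> M \<Longrightarrow> ip z (x + y) = ip z x + ip z y"
  by (simp add: ip_def compose_add_left tr_add)

lemma ip_diff_left: "x \<in> M \<Longrightarrow> y \<in> M \<Longrightarrow> z \<in> M \<Longrightarrow> ip (x - y) z = ip x z - ip y z"
  by (simp add: ip_def compose_diff_right tr_diff)

lemma ip_diff_right: "x \<in> M \<Longrightarrow> y \<in> M \<Longrightarrow> z \<in> M \<Longrightarrow> ip z (x - y) = ip z x - ip z y"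
  by (simp add: ip_def compose_diff_left tr_diff)

lemma ip_scaleC_left: "x \<in> M \<Longrightarrow> y \<in> M \<Longrightarrow> ip (c *\<^sub>C x) y = c * ip x y"
  by (simp add: ip_def tr_scaleC)

lemma ip_scaleC_right: "x \<in> M \<Longrightarrow> y \<in> M \<Longrightarrow> ip x (c *\<^sub>C y) = cnj c * ip x y"
  by (simp add: ip_def tr_scaleC)

lemma ip_zero_left [simp]: "y \<in> M \<Longrightarrow> ip 0 y = 0"
  using ip_diff_left[of 0 0 y] by simp

lemma ip_zero_right [simp]: "y \<in> M \<Longrightarrow> ip y 0 = 0"
  using ip_diff_right[of 0 0 y] by simp

lemma ip_sum_left:
  assumes "\<And>i. i \<in> I \<Longrightarrow> f i \<in> M" "y \<in> M"
  shows "ip (\<Sum>i\<in>I. f i) y = (\<Sum>i\<in>I. ip (f i) y)"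
  using assms by (induction I rule: infinite_finite_induct) (simp_all add: ip_add_left)

lemma ip_sum_right:
  assumes "\<And>i. i \<in> I \<Longrightarrow> f i \<in> M" "y \<in> M"
  shows "ip y (\<Sum>i\<in>I. f i) = (\<Sum>i\<in>I. ip y (f i))"
  using assms by (induction I rule: infinite_finite_induct) (simp_all add: ip_add_right)

lemma ip_self_nonneg: "x \<in> M \<Longrightarrow> ip x x \<in> \<real>\<^sub>\<ge>\<^sub>0"
  by (simp add: ip_def tr_nonneg op_nonneg_adj_compose bounded_op)

lemma ip_self: "x \<in> M \<Longrightarrow> ip x x = complex_of_real ((norm2 tr x)\<^sup>2)"
  using ip_self_nonneg[of x]
  by (auto simp: complex_nonneg_Reals_iff norm2_def ip_def complex_eq_iff)

lemma norm2_power2: "x \<in> M \<Longrightarrow> (norm2 tr x)\<^sup>2 = Re (ip x x)"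
  by (simp add: ip_self)

lemma norm2_nonneg [simp]: "x \<in> M \<Longrightarrow> 0 \<le> norm2 tr x"
  using ip_self_nonneg[of x] by (simp add: norm2_def complex_nonneg_Reals_iff ip_def)

text \<open>A sesquilinear form with real diagonal is Hermitian, by polarisation.\<close>

lemma ip_commute:
  assumes x: "x \<in> M" and y: "y \<in> M"
  shows "ip y x = cnj (ip x y)"
proof -
  have real: "Im (ip z z) = 0" if "z \<in> M" for z
    using ip_self[OF that] by simp
  have "Im (ip (x + y) (x + y)) = 0" "Im (ip (x + \<i> *\<^sub>C y) (x + \<i> *\<^sub>C y)) = 0"
    using x y by (intro real; simp)+
  then show ?thesis
    using x y real[OF x] real[OF y]
    by (simp add: ip_add_left ip_add_right ip_scaleC_left ip_scaleC_right complex_eq_iff)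
qed

lemma tr_adj: "x \<in> M \<Longrightarrow> tr (adj x) = cnj (tr x)"
  using ip_commute[of x id_blinfun] by (simp add: ip_def)

lemma ip_mult_left: "a \<in> M \<Longrightarrow> x \<in> M \<Longrightarrow> y \<in> M \<Longrightarrow> ip (a o\<^sub>L x) y = ip x (adj a o\<^sub>L y)"
  by (simp add: ip_def compose_assoc)

lemma ip_mult_right: "a \<in> M \<Longrightarrow> x \<in> M \<Longrightarrow> y \<in> M \<Longrightarrow> ip (x o\<^sub>L a) y = ip x (y o\<^sub>L adj a)"
  using tr_commute[of "adj y o\<^sub>L x" a] by (simp add: ip_def compose_assoc)

lemma norm2_eq_0:
  assumes "x \<in> M" "norm2 tr x = 0"
  shows "x = 0"
proof -
  have "tr (adj x o\<^sub>L x) = 0"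
    using ip_self[OF assms(1)] assms(2) by (simp add: ip_def)
  then have "adj x o\<^sub>L x = 0"
    using assms by (intro tr_faithful) (simp_all add: op_nonneg_adj_compose bounded_op)
  then have "cinner (x h) (x h) = 0" for h
    using cinner_adj_left[OF bounded_op[OF assms(1)], of "x h" h]
    by (metis blinfun.zero_left blinfun_apply_blinfun_compose cinner_zero_left)
  then show ?thesis
    by (intro blinfun_eqI) (simp add: cinner_self blinfun.zero_left)
qed

lemma norm2_zero [simp]: "norm2 tr 0 = 0"
  using norm2_power2[of 0] by simp

lemma norm2_scaleC: "x \<in> M \<Longrightarrow> norm2 tr (c *\<^sub>C x) = cmod c * norm2 tr x"
proof (rule power2_eq_imp_eq)
  assume x: "x \<in> M"
  have "ip (c *\<^sub>C x) (c *\<^sub>C x) = (c * cnj c) * ip x x"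
    using x by (simp add: ip_scaleC_left ip_scaleC_right)
  then have "(norm2 tr (c *\<^sub>C x))\<^sup>2 = Re ((c * cnj c) * ip x x)"
    using x by (simp only: norm2_power2 closed)
  also have "\<dots> = (cmod c * norm2 tr x)\<^sup>2"
    using x by (simp only: complex_norm_square[symmetric] ip_self) (simp add: power_mult_distrib)
  finally show "(norm2 tr (c *\<^sub>C x))\<^sup>2 = (cmod c * norm2 tr x)\<^sup>2" .
qed auto

lemma norm2_minus_commute: "x \<in> M \<Longrightarrow> y \<in> M \<Longrightarrow> norm2 tr (x - y) = norm2 tr (y - x)"
  using norm2_scaleC[of "y - x" "- 1"] by (simp add: scaleC_minus1)

lemma norm2_adj: "x \<in> M \<Longrightarrow> norm2 tr (adj x) = norm2 tr x"
  using tr_commute[of x "adj x"] by (simp add: norm2_def)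

lemma norm2_add_power2:
  "x \<in> M \<Longrightarrow> y \<in> M \<Longrightarrow>
    (norm2 tr (x + y))\<^sup>2 = (norm2 tr x)\<^sup>2 + 2 * Re (ip x y) + (norm2 tr y)\<^sup>2"
  by (simp add: norm2_power2 ip_add_left ip_add_right ip_commute[of x y])

lemma norm2_diff_power2:
  "x \<in> M \<Longrightarrow> y \<in> M \<Longrightarrow>
    (norm2 tr (x - y))\<^sup>2 = (norm2 tr x)\<^sup>2 - 2 * Re (ip x y) + (norm2 tr y)\<^sup>2"
  by (simp add: norm2_power2 ip_diff_left ip_diff_right ip_commute[of x y])

lemma cauchy_schwarz:
  assumes x: "x \<in> M" and y: "y \<in> M"
  shows "cmod (ip x y) \<le> norm2 tr x * norm2 tr y"
proof (cases "norm2 tr y = 0")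
  case True
  then show ?thesis
    using norm2_eq_0[OF y] x by simp
next
  case False
  define c where "c = ip x y / complex_of_real ((norm2 tr y)\<^sup>2)"
  \<comment> \<open>Subtract from \<open>x\<close> its orthogonal projection \<open>c y\<close> onto the line through \<open>y\<close>.\<close>
  have "0 \<le> (norm2 tr (x - c *\<^sub>C y))\<^sup>2" by simp
  also have "\<dots> = (norm2 tr x)\<^sup>2 - 2 * Re (cnj c * ip x y) + (cmod c * norm2 tr y)\<^sup>2"
    using x y by (simp add: norm2_diff_power2 ip_scaleC_right norm2_scaleC)
  also have "cnj c * ip x y = complex_of_real ((cmod (ip x y))\<^sup>2 / (norm2 tr y)\<^sup>2)"
    using complex_norm_square[of "ip x y"] by (simp add: c_def mult.commute)
  also have "cmod c * norm2 tr y = cmod (ip x y) / norm2 tr y"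
  proof -
    have "cmod c = cmod (ip x y) / (norm2 tr y)\<^sup>2"
      by (simp only: c_def norm_divide norm_of_real abs_power2)
    then show ?thesis
      using False by (simp only: power2_eq_square) simp
  qed
  finally have "(cmod (ip x y))\<^sup>2 \<le> (norm2 tr x * norm2 tr y)\<^sup>2"
    using False by (simp add: power_divide power_mult_distrib field_simps)
  then show ?thesis
    by (rule power2_le_imp_le) (use x y in simp)
qed

lemma norm2_triangle:
  assumes "x \<in> M" "y \<in> M"
  shows "norm2 tr (x + y) \<le> norm2 tr x + norm2 tr y"
proof (rule power2_le_imp_le)
  have "Re (ip x y) \<le> norm2 tr x * norm2 tr y"
    using cauchy_schwarz[OF assms] complex_Re_le_cmod[of "ip x y"] by linarith
  then show "(norm2 tr (x + y))\<^sup>2 \<le> (norm2 tr x + norm2 tr y)\<^sup>2"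
    using assms by (simp add: norm2_add_power2 power2_sum)
qed (use assms in auto)

lemma norm2_triangle_diff:
  assumes "x \<in> M" "y \<in> M"
  shows "norm2 tr (x - y) \<le> norm2 tr x + norm2 tr y"
  using norm2_triangle[of x "(- 1) *\<^sub>C y"] norm2_scaleC[of y "- 1"] assms
    closed(4)[of y "- 1"]
  by (simp add: scaleC_minus1)

lemma norm2_triangle_sub:
  assumes "x \<in> M" "y \<in> M"
  shows "norm2 tr x \<le> norm2 tr y + norm2 tr (x - y)"
  using norm2_triangle[of y "x - y"] assms by simp

lemma norm2_dist_triangle:
  assumes "x \<in> M" "y \<in> M" "z \<in> M"
  shows "norm2 tr (x - z) \<le> norm2 tr (x - y) + norm2 tr (y - z)"
  using norm2_triangle[of "x - y" "y - z"] assms by simp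

lemma norm2_sum_le:
  assumes "\<And>i. i \<in> I \<Longrightarrow> f i \<in> M"
  shows "norm2 tr (\<Sum>i\<in>I. f i) \<le> (\<Sum>i\<in>I. norm2 tr (f i))"
  using assms
proof (induction I rule: infinite_finite_induct)
  case (insert i I)
  then show ?case
    using norm2_triangle[of "f i" "sum f I"] by (auto simp del: closed(1))
qed auto

text \<open>Left multiplication is controlled by \<open>a\<^sup>* a \<le> \<parallel>a\<parallel>\<^sup>2\<close>. By traciality the adjoint is isometric for
  the 2-norm, which reduces right multiplication to the left one.\<close>

lemma norm2_mult_left:
  assumes "a \<in> M" "x \<in> M"
  shows "norm2 tr (a o\<^sub>L x) \<le> norm a * norm2 tr x"
proof (rule power2_le_imp_le)
  define P where "P = complex_of_real ((norm a)\<^sup>2) *\<^sub>C id_blinfun - (adj a o\<^sub>L a)"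
  have "op_nonneg (adj x o\<^sub>L P o\<^sub>L x)"
    unfolding P_def using assms by (intro op_nonneg_sandwich op_nonneg_norm_le) (auto simp: bounded_op)
  moreover have "P \<in> M"
    using assms by (auto simp: P_def)
  ultimately have "0 \<le> Re (tr (adj x o\<^sub>L P o\<^sub>L x))"
    using tr_nonneg[of "adj x o\<^sub>L P o\<^sub>L x"] assms by (simp add: complex_nonneg_Reals_iff)
  also have "tr (adj x o\<^sub>L P o\<^sub>L x) = complex_of_real ((norm a)\<^sup>2) * ip x x - ip (a o\<^sub>L x) (a o\<^sub>L x)"
    using assms by (simp add: P_def compose_diff_left compose_diff_right tr_diff tr_scaleC ip_def
        compose_assoc)
  finally show "(norm2 tr (a o\<^sub>L x))\<^sup>2 \<le> (norm a * norm2 tr x)\<^sup>2"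
    using assms by (simp add: ip_self power_mult_distrib)
qed (use assms in auto)

lemma norm2_mult_right:
  assumes "a \<in> M" "x \<in> M"
  shows "norm2 tr (x o\<^sub>L a) \<le> norm a * norm2 tr x"
proof -
  have "norm2 tr (x o\<^sub>L a) = norm2 tr (adj a o\<^sub>L adj x)"
    using norm2_adj[of "x o\<^sub>L a"] assms by simp
  also have "\<dots> \<le> norm (adj a) * norm2 tr (adj x)"
    using assms by (intro norm2_mult_left) auto
  also have "\<dots> \<le> norm a * norm2 tr x"
    using assms by (auto simp: norm2_adj bounded_op intro!: mult_right_mono norm_adj_le)
  finally show ?thesis .
qed

lemma norm2_id: "norm2 tr id_blinfun = 1"
  by (simp add: norm2_def tr_id)

lemma norm2_le_norm: "x \<in> M \<Longrightarrow> norm2 tr x \<le> norm x"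
  using norm2_mult_left[of x id_blinfun] by (simp add: norm2_id)

lemma norm2_unitary_left:
  assumes "u \<in> M" "x \<in> M" "unitary u"
  shows "norm2 tr (u o\<^sub>L x) = norm2 tr x"
proof -
  have "adj x o\<^sub>L adj u o\<^sub>L (u o\<^sub>L x) = adj x o\<^sub>L ((adj u o\<^sub>L u) o\<^sub>L x)"
    by (simp only: compose_assoc)
  then show ?thesis
    using assms by (simp add: norm2_def unitary_def)
qed

lemma unitary_adj: "u \<in> M \<Longrightarrow> unitary u \<Longrightarrow> unitary (adj u)"
  by (simp add: unitary_def)

lemma norm2_unitary_right:
  assumes "u \<in> M" "x \<in> M" "unitary u"
  shows "norm2 tr (x o\<^sub>L u) = norm2 tr x"
proof -
  have "norm2 tr (x o\<^sub>L u) = norm2 tr (adj u o\<^sub>L adj x)"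
    using norm2_adj[of "x o\<^sub>L u"] assms by simp
  then show ?thesis
    using assms by (simp add: norm2_unitary_left unitary_adj norm2_adj)
qed

lemma norm2_unitary: "u \<in> M \<Longrightarrow> unitary u \<Longrightarrow> norm2 tr u = 1"
  by (simp add: norm2_def unitary_def tr_id)

end

section \<open>Conditional expectations\<close>

lemma is_cond_expD:
  assumes "is_cond_exp M tr N E"
  shows "x \<in> M \<Longrightarrow> E x \<in> N"
    and "x \<in> M \<Longrightarrow> y \<in> M \<Longrightarrow> E (x + y) = E x + E y"
    and "x \<in> M \<Longrightarrow> E (c *\<^sub>C x) = c *\<^sub>C E x"
    and "x \<in> M \<Longrightarrow> op_nonneg x \<Longrightarrow> op_nonneg (E x)"
    and "a \<in> N \<Longrightarrow> E a = a"
    and "a \<in> N \<Longrightarrow> b \<in> N \<Longrightarrow> x \<in> M \<Longrightarrow> E (a o\<^sub>L x o\<^sub>L b) = a o\<^sub>L E x o\<^sub>L b"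
    and "x \<in> M \<Longrightarrow> tr (E x) = tr x"
  using assms by (simp_all add: is_cond_exp_def)

locale cond_expectation = traced_algebra +
  fixes N and E
  assumes sub: "star_subalgebra N M"
    and id_sub [simp, intro]: "id_blinfun \<in> N"
    and expect: "is_cond_exp M tr N E"
begin

lemma sub_in: "x \<in> N \<Longrightarrow> x \<in> M"
  by (rule star_subalgebra_in[OF sub])

lemma sub_closed [simp, intro]:
  shows "x \<in> N \<Longrightarrow> y \<in> N \<Longrightarrow> x + y \<in> N"
    and "x \<in> N \<Longrightarrow> y \<in> N \<Longrightarrow> x - y \<in> N"
    and "x \<in> N \<Longrightarrow> y \<in> N \<Longrightarrow> x o\<^sub>L y \<in> N"
    and "x \<in> N \<Longrightarrow> c *\<^sub>C x \<in> N"
    and "x \<in> N \<Longrightarrow> adj x \<in> N"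
    and "0 \<in> N"
  using star_subalgebra_add[OF sub] star_subalgebra_diff[OF sub] star_subalgebra_scaleC[OF sub]
    star_subalgebra_zero[OF sub] star_subalgebra_compose[OF sub] star_subalgebra_adj[OF sub]
  by auto

lemmas E_in_sub [simp, intro] = is_cond_expD(1)[OF expect]
lemmas E_add = is_cond_expD(2)[OF expect]
lemmas E_scaleC = is_cond_expD(3)[OF expect]
lemmas E_nonneg = is_cond_expD(4)[OF expect]
lemmas E_sub = is_cond_expD(5)[OF expect]
lemmas E_bimodule = is_cond_expD(6)[OF expect]
lemmas E_tr = is_cond_expD(7)[OF expect]

lemma E_in [simp, intro]: "x \<in> M \<Longrightarrow> E x \<in> M"
  by (simp add: sub_in)

lemma E_diff: "x \<in> M \<Longrightarrow> y \<in> M \<Longrightarrow> E (x - y) = E x - E y"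
  using E_add[of "x - y" y] by simp

lemma E_left: "a \<in> N \<Longrightarrow> x \<in> M \<Longrightarrow> E (a o\<^sub>L x) = a o\<^sub>L E x"
  using E_bimodule[of a id_blinfun x] by simp

lemma E_right: "b \<in> N \<Longrightarrow> x \<in> M \<Longrightarrow> E (x o\<^sub>L b) = E x o\<^sub>L b"
  using E_bimodule[of id_blinfun b x] by simp

text \<open>On \<open>M\<close>, the map \<open>E\<close> is the restriction of the orthogonal projection of \<open>L\<^sup>2(M)\<close> onto the closure
  of \<open>N\<close>. This determines it.\<close>

lemma ip_E: "x \<in> M \<Longrightarrow> b \<in> N \<Longrightarrow> ip (E x) b = ip x b"
  using E_left[of "adj b" x] E_tr[of "adj b o\<^sub>L x"] by (simp add: ip_def sub_in)

lemma E_unique: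
  assumes x: "x \<in> M" and a: "a \<in> N" and eq: "\<And>b. b \<in> N \<Longrightarrow> ip a b = ip x b"
  shows "E x = a"
proof -
  have "ip (E x - a) (E x - a) = 0"
    using assms by (subst ip_diff_left) (simp_all add: ip_E sub_in)
  then have "norm2 tr (E x - a) = 0"
    using x a by (simp add: ip_self sub_in)
  then show ?thesis
    using norm2_eq_0[of "E x - a"] x a by (simp add: sub_in)
qed

lemma norm2_pythagoras:
  assumes "x \<in> M"
  shows "(norm2 tr (x - E x))\<^sup>2 = (norm2 tr x)\<^sup>2 - (norm2 tr (E x))\<^sup>2"
proof -
  have "Re (ip x (E x)) = (norm2 tr (E x))\<^sup>2"
    using ip_E[of x "E x"] assms by (simp add: norm2_power2)
  then show ?thesis
    using assms by (simp add: norm2_diff_power2)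
qed

lemma norm2_E_le:
  assumes "x \<in> M"
  shows "norm2 tr (E x) \<le> norm2 tr x"
proof (rule power2_le_imp_le)
  have "0 \<le> (norm2 tr (x - E x))\<^sup>2" by simp
  then show "(norm2 tr (E x))\<^sup>2 \<le> (norm2 tr x)\<^sup>2"
    unfolding norm2_pythagoras[OF assms] by simp
qed (use assms in simp)

lemma E_adj:
  assumes "x \<in> M"
  shows "E (adj x) = adj (E x)"
proof (rule E_unique)
  fix b assume b: "b \<in> N"
  have "tr (adj b o\<^sub>L adj (E x)) = cnj (tr (E x o\<^sub>L b))"
    using tr_adj[of "E x o\<^sub>L b"] b assms by (simp add: sub_in)
  also have "tr (E x o\<^sub>L b) = tr (x o\<^sub>L b)"
    using E_right[OF b assms] E_tr[of "x o\<^sub>L b"] b assms by (simp add: sub_in)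
  also have "cnj (tr (x o\<^sub>L b)) = tr (adj b o\<^sub>L adj x)"
    using tr_adj[of "x o\<^sub>L b"] b assms by (simp add: sub_in)
  finally show "ip (adj (E x)) b = ip (adj x) b"
    by (simp add: ip_def)
qed (use assms in auto)

text \<open>Kadison--Schwarz: apply the positive map \<open>E\<close> to \<open>(x - E x)\<^sup>* (x - E x)\<close> and expand
  by means of the bimodule property.\<close>

lemma kadison_schwarz:
  assumes x: "x \<in> M"
  shows "op_nonneg (E (adj x o\<^sub>L x) - (adj (E x) o\<^sub>L E x))"
proof -
  have "op_nonneg (E (adj (x - E x) o\<^sub>L (x - E x)))"
    using x by (intro E_nonneg op_nonneg_adj_compose) (auto simp: bounded_op)
  also have "adj (x - E x) o\<^sub>L (x - E x)
      = (adj x o\<^sub>L x) - (adj x o\<^sub>L E x) - (adj (E x) o\<^sub>L x) + (adj (E x) o\<^sub>L E x)"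
    using x by (simp add: compose_diff_left compose_diff_right algebra_simps)
  also have "E \<dots> = E (adj x o\<^sub>L x) - (adj (E x) o\<^sub>L E x)"
    using x by (simp add: E_add E_diff E_left E_right E_sub E_adj)
  finally show ?thesis .
qed

lemma norm_E_unitary:
  assumes "u \<in> M" "unitary u"
  shows "norm (E u) \<le> 1"
  using kadison_schwarz[of u] assms
  by (intro norm_le_1I) (simp_all add: bounded_op unitary_def E_sub)

text \<open>Any two conditional expectations onto \<open>N\<close> have the same inner products with \<open>N\<close> and therefore
  agree on \<open>M\<close>, so the description in \<^const>\<open>cond_exp\<close> has exactly one solution.\<close>

lemma cond_exp_eq:
  assumes x: "x \<in> M"
  shows "cond_exp M tr N x = E x"
proof -
  have cong: "is_cond_exp M tr N (restrict E M)"
    using expect by (auto simp: is_cond_exp_def sub_in)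
  have "cond_exp M tr N = restrict E M"
    unfolding cond_exp_def
  proof (rule the_equality)
    fix F assume F: "F \<in> extensional M \<and> is_cond_exp M tr N F"
    interpret F: cond_expectation M tr N F
      by unfold_locales (use F sub in auto)
    show "F = restrict E M"
    proof (rule extensionalityI[of _ M])
      fix y assume "y \<in> M"
      then show "F y = restrict E M y"
        using E_unique[of y "F y"] F.ip_E[of y] by simp
    qed (use F in auto)
  qed (use cong in simp)
  then show ?thesis
    using x by simp
qed

lemma cond_expectation_conjugate:
  assumes u: "u \<in> M" "unitary u"
  shows "cond_expectation M tr {u o\<^sub>L a o\<^sub>L adj u | a. a \<in> N}
    (\<lambda>x. u o\<^sub>L E (adj u o\<^sub>L x o\<^sub>L u) o\<^sub>L adj u)"
proof -
  have uu: "adj u o\<^sub>L u = id_blinfun" "u o\<^sub>L adj u = id_blinfun"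
    using u by (simp_all add: unitary_def)
  have uu': "adj u o\<^sub>L (u o\<^sub>L x) = x" "u o\<^sub>L (adj u o\<^sub>L x) = x" for x
    by (simp_all add: compose_assoc[symmetric] uu)
  let ?N = "{u o\<^sub>L a o\<^sub>L adj u | a. a \<in> N}"
  let ?E = "\<lambda>x. u o\<^sub>L E (adj u o\<^sub>L x o\<^sub>L u) o\<^sub>L adj u"
  have sub': "star_subalgebra ?N M"
    unfolding star_subalgebra_def
  proof (intro conjI ballI complex_vector.subspaceI)
    show "?N \<subseteq> M"
      using u by (auto intro!: closed(3) simp: sub_in)
    show "0 \<in> ?N"
      by (auto intro!: exI[of _ 0])
    show "x + y \<in> ?N" if "x \<in> ?N" "y \<in> ?N" for x y
      using that by (auto simp flip: compose_add_left compose_add_right)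
    show "c *\<^sub>C x \<in> ?N" if "x \<in> ?N" for c x
    proof -
      from that obtain a where a: "a \<in> N" "x = u o\<^sub>L a o\<^sub>L adj u" by auto
      then have "c *\<^sub>C x = u o\<^sub>L (c *\<^sub>C a) o\<^sub>L adj u"
        using u by simp
      then show ?thesis using a by blast
    qed
    show "x o\<^sub>L y \<in> ?N" if "x \<in> ?N" "y \<in> ?N" for x y
    proof -
      from that obtain a b where a: "a \<in> N" "x = u o\<^sub>L a o\<^sub>L adj u"
        and b: "b \<in> N" "y = u o\<^sub>L b o\<^sub>L adj u" by auto
      then have "x o\<^sub>L y = u o\<^sub>L (a o\<^sub>L b) o\<^sub>L adj u"
        by (simp add: compose_assoc uu')
      then show ?thesis using a b by blast
    qed
    show "adj x \<in> ?N" if "x \<in> ?N" for x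
    proof -
      from that obtain a where a: "a \<in> N" "x = u o\<^sub>L a o\<^sub>L adj u" by auto
      then have "adj x = u o\<^sub>L adj a o\<^sub>L adj u"
        using u by (simp add: sub_in compose_assoc)
      then show ?thesis using a by blast
    qed
  qed
  have "is_cond_exp M tr ?N ?E"
    unfolding is_cond_exp_def
  proof (intro conjI ballI allI impI)
    show "?E x \<in> ?N" if "x \<in> M" for x
      using that u by auto
    show "?E (x + y) = ?E x + ?E y" if "x \<in> M" "y \<in> M" for x y
      using that u by (simp add: compose_add_left compose_add_right E_add)
    show "?E (c *\<^sub>C x) = c *\<^sub>C ?E x" if "x \<in> M" for c x
      using that u by (simp add: E_scaleC)
    show "op_nonneg (?E x)" if "x \<in> M" "op_nonneg x" for x
    proof -
      have "op_nonneg (adj (adj u) o\<^sub>L E (adj u o\<^sub>L x o\<^sub>L u) o\<^sub>L adj u)"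
        using that u by (intro op_nonneg_sandwich E_nonneg) (auto simp: bounded_op)
      then show ?thesis using u by simp
    qed
    show "?E a = a" if "a \<in> ?N" for a
    proof -
      from that obtain b where b: "b \<in> N" "a = u o\<^sub>L b o\<^sub>L adj u" by auto
      then have "adj u o\<^sub>L a o\<^sub>L u = b"
        by (simp add: compose_assoc uu' uu)
      then show ?thesis using b by (simp add: E_sub)
    qed
    show "?E (a o\<^sub>L x o\<^sub>L b) = a o\<^sub>L ?E x o\<^sub>L b" if "a \<in> ?N" "b \<in> ?N" "x \<in> M" for a b x
    proof -
      from that obtain c d where c: "c \<in> N" "a = u o\<^sub>L c o\<^sub>L adj u"
        and d: "d \<in> N" "b = u o\<^sub>L d o\<^sub>L adj u" by auto
      have "adj u o\<^sub>L (a o\<^sub>L x o\<^sub>L b) o\<^sub>L u = c o\<^sub>L (adj u o\<^sub>L x o\<^sub>L u) o\<^sub>L d"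
        by (simp add: c d compose_assoc uu' uu)
      then have "?E (a o\<^sub>L x o\<^sub>L b) = u o\<^sub>L (c o\<^sub>L E (adj u o\<^sub>L x o\<^sub>L u) o\<^sub>L d) o\<^sub>L adj u"
        using c d that u by (simp add: E_bimodule)
      then show ?thesis
        by (simp add: c d compose_assoc uu' uu)
    qed
    show "tr (?E x) = tr x" if "x \<in> M" for x
    proof -
      have "tr (?E x) = tr (adj u o\<^sub>L (u o\<^sub>L E (adj u o\<^sub>L x o\<^sub>L u)))"
        using that u by (intro tr_commute) auto
      also have "\<dots> = tr (adj u o\<^sub>L x o\<^sub>L u)"
        using that u by (simp add: uu' E_tr)
      also have "\<dots> = tr (u o\<^sub>L (adj u o\<^sub>L x))"
        using that u by (intro tr_commute) auto
      finally show ?thesis by (simp add: uu')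
    qed
  qed
  moreover have "id_blinfun \<in> ?N"
    using uu(2) by (auto intro!: exI[of _ id_blinfun])
  ultimately show ?thesis
    using sub' by unfold_locales auto
qed

end

section \<open>Consequences of the asymptotic homomorphism property\<close>

lemma op_pow_Suc [simp]: "op_pow u (Suc n) = u o\<^sub>L op_pow u n"
  by (simp add: op_pow_def)

lemma op_pow_0 [simp]: "op_pow u 0 = id_blinfun"
  by (simp add: op_pow_def)

context cond_expectation
begin

lemma op_pow_in: "u \<in> N \<Longrightarrow> op_pow u n \<in> N"
  by (induction n) auto

lemma unitary_pow_in: "u \<in> N \<Longrightarrow> unitary_pow u j \<in> N"
  by (simp add: unitary_pow_def op_pow_in)

lemma unitary_compose: "u \<in> M \<Longrightarrow> w \<in> M \<Longrightarrow> unitary u \<Longrightarrow> unitary w \<Longrightarrow> unitary (u o\<^sub>L w)"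
proof -
  assume "u \<in> M" "w \<in> M" "unitary u" "unitary w"
  moreover have "adj w o\<^sub>L adj u o\<^sub>L (u o\<^sub>L w) = adj w o\<^sub>L ((adj u o\<^sub>L u) o\<^sub>L w)"
    "u o\<^sub>L w o\<^sub>L (adj w o\<^sub>L adj u) = u o\<^sub>L ((w o\<^sub>L adj w) o\<^sub>L adj u)"
    by (simp_all only: compose_assoc)
  ultimately show ?thesis by (simp add: unitary_def)
qed

lemma unitary_op_pow: "u \<in> N \<Longrightarrow> unitary u \<Longrightarrow> unitary (op_pow u n)"
proof (induction n)
  case 0
  show ?case by (simp add: unitary_def)
next
  case (Suc n)
  then show ?case
    by (auto intro!: unitary_compose simp: sub_in op_pow_in)
qed

lemma unitary_unitary_pow: "u \<in> N \<Longrightarrow> unitary u \<Longrightarrow> unitary (unitary_pow u j)"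
  by (simp add: unitary_pow_def unitary_op_pow unitary_adj sub_in)

end

locale abelian_expectation = cond_expectation +
  assumes commute: "a \<in> N \<Longrightarrow> b \<in> N \<Longrightarrow> a o\<^sub>L b = b o\<^sub>L a"

text \<open>The property enters through the nonnegative powers of the unitary, abstracted here to a sequence
  of unitaries of \<open>N\<close> along which \<open>E\<close> is asymptotically multiplicative.\<close>

locale asymptotically_multiplicative = abelian_expectation +
  fixes w :: "nat \<Rightarrow> 'a op"
  assumes w_in [simp, intro]: "w n \<in> N"
    and w_unitary: "unitary (w n)"
    and w_limit: "x \<in> M \<Longrightarrow> y \<in> M \<Longrightarrow>
      (\<lambda>n. norm2 tr (E (x o\<^sub>L w n o\<^sub>L y) - (E x o\<^sub>L E y o\<^sub>L w n))) \<longlonglongrightarrow> 0"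
begin

lemma w_in_M [simp, intro]: "w n \<in> M"
  by (simp add: sub_in)

lemma adj_w: "adj (w n) o\<^sub>L w n = id_blinfun"
  using w_unitary[of n] by (simp add: unitary_def)

text \<open>If \<open>b\<close> commutes with \<open>N\<close>, then \<open>b w\<^sub>n b\<^sup>* = b b\<^sup>* w\<^sub>n\<close>, so \<open>E (b b\<^sup>*) w\<^sub>n - E b E (b\<^sup>*) w\<^sub>n\<close> tends
  to \<open>0\<close>. The unitaries do not change its 2-norm, hence \<open>E (b b\<^sup>*) = E b (E b)\<^sup>*\<close>, and taking
  traces shows that \<open>b\<close> and \<open>E b\<close> have the same 2-norm.\<close>

lemma relative_commutant_subset:
  assumes b: "b \<in> M" and comm: "\<And>a. a \<in> N \<Longrightarrow> b o\<^sub>L a = a o\<^sub>L b"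
  shows "b \<in> N"
proof -
  let ?d = "E (b o\<^sub>L adj b) - (E b o\<^sub>L E (adj b))"
  have "norm2 tr (E (b o\<^sub>L w n o\<^sub>L adj b) - (E b o\<^sub>L E (adj b) o\<^sub>L w n)) = norm2 tr ?d" for n
  proof -
    have comm': "a o\<^sub>L adj b = adj b o\<^sub>L a" if "a \<in> N" for a
      using arg_cong[OF comm[of "adj a"], of adj] that b by (simp add: sub_in)
    have "b o\<^sub>L w n o\<^sub>L adj b = b o\<^sub>L adj b o\<^sub>L w n"
      by (simp add: compose_assoc comm')
    then have "E (b o\<^sub>L w n o\<^sub>L adj b) = E (b o\<^sub>L adj b) o\<^sub>L w n"
      using b by (simp add: E_right)
    then have "E (b o\<^sub>L w n o\<^sub>L adj b) - (E b o\<^sub>L E (adj b) o\<^sub>L w n) = ?d o\<^sub>L w n"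
      by (simp add: compose_diff_left)
    then show ?thesis
      using b by (simp add: norm2_unitary_right w_unitary)
  qed
  then have "(\<lambda>n. norm2 tr ?d) \<longlonglongrightarrow> 0"
    using w_limit[of b "adj b"] b by simp
  then have "norm2 tr ?d = 0"
    using LIMSEQ_unique by blast
  then have "?d = 0"
    using b by (intro norm2_eq_0) auto
  then have "tr (b o\<^sub>L adj b) = tr (E b o\<^sub>L adj (E b))"
    using b E_tr[of "b o\<^sub>L adj b"] by (simp add: E_adj)
  then have "tr (adj b o\<^sub>L b) = tr (adj (E b) o\<^sub>L E b)"
    using b tr_commute[of b "adj b"] tr_commute[of "E b" "adj (E b)"] by simp
  then have "norm2 tr (b - E b) = 0"
    using norm2_pythagoras[OF b] by (simp add: norm2_def)
  then have "b = E b"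
    using norm2_eq_0[of "b - E b"] b by simp
  then show ?thesis
    using b E_in_sub by metis
qed

lemma masa: "masa M N"
  unfolding masa_def
proof (intro conjI allI impI)
  show "star_subalgebra N M" by (rule sub)
  show "abelian N" using commute by (simp add: abelian_def)
  fix B assume B: "star_subalgebra B M \<and> abelian B \<and> N \<subseteq> B"
  have "B \<subseteq> N"
    using B by (auto intro!: relative_commutant_subset simp: abelian_def dest: star_subalgebra_in)
  then show "B = N" using B by blast
qed

lemma norm2_E_sandwich_limit:
  assumes "x \<in> M" "y \<in> M"
  obtains \<delta> where "\<delta> \<longlonglongrightarrow> 0"
    and "\<And>n. norm2 tr (E (x o\<^sub>L w n o\<^sub>L y)) \<le> norm2 tr (E x o\<^sub>L E y) + \<delta> n"
proof
  show "(\<lambda>n. norm2 tr (E (x o\<^sub>L w n o\<^sub>L y) - (E x o\<^sub>L E y o\<^sub>L w n))) \<longlonglongrightarrow> 0"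
    using assms by (rule w_limit)
  show "norm2 tr (E (x o\<^sub>L w n o\<^sub>L y)) \<le> norm2 tr (E x o\<^sub>L E y)
      + norm2 tr (E (x o\<^sub>L w n o\<^sub>L y) - (E x o\<^sub>L E y o\<^sub>L w n))" for n
    using norm2_triangle_sub[of "E (x o\<^sub>L w n o\<^sub>L y)" "E x o\<^sub>L E y o\<^sub>L w n"] assms
    by (simp add: norm2_unitary_right w_unitary)
qed

text \<open>The elements \<open>u w\<^sub>n u\<^sup>*\<close> of the unit ball of \<open>u N u\<^sup>*\<close> witness the bound: they are fixed by the
  expectation onto \<open>u N u\<^sup>*\<close> and have 2-norm 1, whereas their images under \<open>E\<close> have 2-norm at
  most \<open>\<parallel>E u E (u\<^sup>*)\<parallel>\<^sub>2 \<le> \<parallel>E u\<parallel>\<^sub>2\<close> in the limit.\<close>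

lemma strongly_singular: "strongly_singular_masa M tr N"
  unfolding strongly_singular_masa_def
proof (intro conjI ballI impI masa)
  fix u assume u: "u \<in> M" "unitary u"
  let ?N = "{u o\<^sub>L a o\<^sub>L adj u | a. a \<in> N}"
  let ?F = "\<lambda>x. u o\<^sub>L E (adj u o\<^sub>L x o\<^sub>L u) o\<^sub>L adj u"
  interpret F: cond_expectation M tr ?N ?F
    by (rule cond_expectation_conjugate[OF u])
  let ?\<phi> = "\<lambda>x. cond_exp M tr ?N x - cond_exp M tr N x"
  define S where "S = norm_inf2 M tr ?\<phi>"
  have bdd: "bdd_above ((\<lambda>x. norm2 tr (?\<phi> x)) ` {x \<in> M. norm x \<le> 1})"
  proof (rule bdd_aboveI2)
    fix x assume x: "x \<in> {x \<in> M. norm x \<le> 1}"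
    then have "norm2 tr (?\<phi> x) \<le> norm2 tr (?F x) + norm2 tr (E x)"
      using F.cond_exp_eq[of x] cond_exp_eq[of x] norm2_triangle_diff[of "?F x" "E x"] F.E_in[of x]
      by simp
    also have "\<dots> \<le> norm2 tr x + norm2 tr x"
      using x F.norm2_E_le[of x] norm2_E_le[of x] by simp
    also have "\<dots> \<le> 1 + 1"
      using x norm2_le_norm[of x] by simp
    finally show "norm2 tr (?\<phi> x) \<le> 2" by simp
  qed
  have S_ge: "norm2 tr (?F x - E x) \<le> S" if "x \<in> M" "norm x \<le> 1" for x
  proof -
    have "norm2 tr (?\<phi> x) \<le> S"
      unfolding S_def norm_inf2_def using that by (intro cSUP_upper[OF _ bdd]) simp
    then show ?thesis
      using that F.cond_exp_eq[of x] cond_exp_eq[of x] by simp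
  qed
  have "0 \<le> norm2 tr (?F 0 - E 0)"
    using F.E_in[of 0] by (intro norm2_nonneg closed(2)) auto
  then have S_nonneg: "0 \<le> S"
    using S_ge[of 0] by simp
  obtain \<delta> where \<delta>: "\<delta> \<longlonglongrightarrow> 0"
    and E_le: "\<And>n. norm2 tr (E (u o\<^sub>L w n o\<^sub>L adj u)) \<le> norm2 tr (E u o\<^sub>L E (adj u)) + \<delta> n"
    using norm2_E_sandwich_limit[of u "adj u"] u by auto
  have "norm2 tr (E u o\<^sub>L E (adj u)) \<le> norm (E (adj u)) * norm2 tr (E u)"
    using u by (intro norm2_mult_right) auto
  also have "\<dots> \<le> 1 * norm2 tr (E u)"
    using u by (intro mult_right_mono norm_E_unitary unitary_adj) auto
  finally have Eu: "norm2 tr (E u o\<^sub>L E (adj u)) \<le> norm2 tr (E u)" by simp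
  have "1 - (norm2 tr (E u) + \<delta> n)\<^sup>2 \<le> S\<^sup>2" for n
  proof -
    let ?x = "u o\<^sub>L w n o\<^sub>L adj u"
    have x: "?x \<in> M" "unitary ?x"
      using u by (auto intro!: unitary_compose unitary_adj w_unitary)
    have "?F ?x = ?x"
      by (rule F.E_sub) auto
    then have "(norm2 tr (?x - E ?x))\<^sup>2 \<le> S\<^sup>2"
      using S_ge[of ?x] x unitary_norm_le_1[OF bounded_op] by (intro power_mono) auto
    then have "1 - (norm2 tr (E ?x))\<^sup>2 \<le> S\<^sup>2"
      using norm2_pythagoras[of ?x] norm2_unitary[of ?x] x by simp
    moreover have "(norm2 tr (E ?x))\<^sup>2 \<le> (norm2 tr (E u) + \<delta> n)\<^sup>2"
      using E_le[of n] Eu x by (intro power_mono) auto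
    ultimately show ?thesis by simp
  qed
  moreover have "(\<lambda>n. 1 - (norm2 tr (E u) + \<delta> n)\<^sup>2) \<longlonglongrightarrow> 1 - (norm2 tr (E u) + 0)\<^sup>2"
    by (intro tendsto_intros \<delta>)
  ultimately have "1 - (norm2 tr (E u) + 0)\<^sup>2 \<le> S\<^sup>2"
    by (intro LIMSEQ_le_const2) auto
  then have "(norm2 tr (u - E u))\<^sup>2 \<le> S\<^sup>2"
    using norm2_pythagoras[OF u(1)] norm2_unitary[OF u] by simp
  then have "norm2 tr (u - E u) \<le> S"
    using S_nonneg power2_le_imp_le by blast
  then show "norm2 tr (u - cond_exp M tr N u) \<le> norm_inf2 M tr ?\<phi>"
    using cond_exp_eq[OF u(1)] by (simp add: S_def)
qed

text \<open>Here \<open>p = v v\<^sup>*\<close> and \<open>q = v\<^sup>* v\<close> are orthogonal because \<open>v\<^sup>2 = 0\<close>, so \<open>E v = p (E v) q = 0\<close> in the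
  abelian algebra \<open>N\<close>. Hence \<open>E\<close> asymptotically annihilates the elements \<open>v w\<^sub>n v\<^sup>*\<close>, whose 2-norm
  is that of \<open>p\<close>.\<close>

lemma popa_delta_one: "popa_delta_one M tr N"
  unfolding popa_delta_one_def
proof (intro conjI ballI impI masa)
  fix v assume v: "v \<in> M"
    and "v o\<^sub>L adj v o\<^sub>L v = v \<and> v o\<^sub>L v = 0 \<and> v o\<^sub>L adj v \<in> N \<and> adj v o\<^sub>L v \<in> N"
  then have pv: "v o\<^sub>L adj v o\<^sub>L v = v" and vv: "v o\<^sub>L v = 0"
    and p: "v o\<^sub>L adj v \<in> N" and q: "adj v o\<^sub>L v \<in> N"
    by auto
  have qv: "adj v o\<^sub>L v o\<^sub>L adj v = adj v"
    using arg_cong[OF pv, of adj] v by (simp add: compose_assoc)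
  let ?X = "{v o\<^sub>L a o\<^sub>L adj v | a. a \<in> N} \<inter> {x. norm x \<le> 1}"
  define S where "S = (SUP x\<in>?X. norm2 tr (x - cond_exp M tr N x))"
  have X_in: "x \<in> M" if "x \<in> ?X" for x
    using that v by (auto intro!: closed(3) simp: sub_in)
  have bdd: "bdd_above ((\<lambda>x. norm2 tr (x - cond_exp M tr N x)) ` ?X)"
  proof (rule bdd_aboveI2)
    fix x assume x: "x \<in> ?X"
    have "norm2 tr (x - cond_exp M tr N x) \<le> norm2 tr x + norm2 tr (E x)"
      using norm2_triangle_diff[of x "E x"] X_in[OF x] by (simp add: cond_exp_eq)
    also have "\<dots> \<le> 1 + 1"
      using norm2_E_le[of x] norm2_le_norm[of x] X_in[OF x] x by auto
    finally show "norm2 tr (x - cond_exp M tr N x) \<le> 2" by simp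
  qed
  have "E v = E (v o\<^sub>L adj v o\<^sub>L v o\<^sub>L (adj v o\<^sub>L v))"
    using pv by (simp add: compose_assoc)
  also have "\<dots> = v o\<^sub>L adj v o\<^sub>L E v o\<^sub>L (adj v o\<^sub>L v)"
    using E_bimodule[OF p q v] by simp
  also have "\<dots> = E v o\<^sub>L (adj v o\<^sub>L (v o\<^sub>L v) o\<^sub>L adj v)"
    using commute[OF p, of "E v o\<^sub>L (adj v o\<^sub>L v)"] v q by (simp add: compose_assoc)
  finally have Ev: "E v = 0"
    by (simp add: vv)
  obtain \<delta> where \<delta>: "\<delta> \<longlonglongrightarrow> 0"
    and E_le: "\<And>n. norm2 tr (E (v o\<^sub>L w n o\<^sub>L adj v)) \<le> norm2 tr (E v o\<^sub>L E (adj v)) + \<delta> n"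
    using norm2_E_sandwich_limit[of v "adj v"] v by auto
  have "adj (id_blinfun - (adj v o\<^sub>L v)) o\<^sub>L (id_blinfun - (adj v o\<^sub>L v)) = id_blinfun - (adj v o\<^sub>L v)"
    using v by (simp add: compose_diff_left compose_diff_right compose_assoc)
      (simp add: compose_assoc[symmetric] qv)
  then have "op_nonneg (id_blinfun - (adj v o\<^sub>L v))"
    using op_nonneg_adj_compose[of "id_blinfun - (adj v o\<^sub>L v)"] v by (simp add: bounded_op)
  then have norm_v: "norm v \<le> 1"
    using v by (intro norm_le_1I) (auto simp: bounded_op)
  then have norm_adj_v: "norm (adj v) \<le> 1"
    using norm_adj_le[OF bounded_op[OF v]] by linarith
  have "norm2 tr (v o\<^sub>L adj v) \<le> S + \<delta> n" for n
  proof -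
    let ?x = "v o\<^sub>L w n o\<^sub>L adj v"
    have "norm ?x \<le> norm v * norm (w n) * norm (adj v)"
      by (meson mult_right_mono norm_blinfun_compose norm_ge_zero order_trans)
    also have "\<dots> \<le> 1 * 1 * 1"
      using norm_v norm_adj_v unitary_norm_le_1[OF bounded_op w_unitary, of n]
      by (intro mult_mono) auto
    finally have x: "?x \<in> ?X"
      by auto
    have "adj ?x o\<^sub>L ?x = v o\<^sub>L adj (w n) o\<^sub>L ((adj v o\<^sub>L v) o\<^sub>L w n) o\<^sub>L adj v"
      using v by (simp add: compose_assoc)
    also have "\<dots> = v o\<^sub>L (adj (w n) o\<^sub>L w n) o\<^sub>L (adj v o\<^sub>L v o\<^sub>L adj v)"
      using commute[OF q w_in] by (simp add: compose_assoc)
    also have "\<dots> = (v o\<^sub>L adj v o\<^sub>L v) o\<^sub>L adj v"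
      by (simp add: adj_w qv pv)
    also have "\<dots> = adj (v o\<^sub>L adj v) o\<^sub>L (v o\<^sub>L adj v)"
      using v by (simp add: compose_assoc)
    finally have "norm2 tr (v o\<^sub>L adj v) = norm2 tr ?x"
      by (simp add: norm2_def)
    also have "\<dots> \<le> norm2 tr (E ?x) + norm2 tr (?x - E ?x)"
      using X_in[OF x] by (intro norm2_triangle_sub) auto
    also have "norm2 tr (?x - E ?x) \<le> S"
      using cSUP_upper[OF x bdd] cond_exp_eq[OF X_in[OF x]] by (simp add: S_def)
    also have "norm2 tr (E ?x) \<le> \<delta> n"
      using E_le[of n] by (simp add: Ev)
    finally show ?thesis by simp
  qed
  moreover have "(\<lambda>n. S + \<delta> n) \<longlonglongrightarrow> S + 0"
    by (intro tendsto_intros \<delta>)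
  ultimately have "norm2 tr (v o\<^sub>L adj v) \<le> S + 0"
    by (intro LIMSEQ_le_const) auto
  then show "norm2 tr (v o\<^sub>L adj v) \<le> (SUP x\<in>?X. norm2 tr (x - cond_exp M tr N x))"
    by (simp add: S_def)
qed

end

lemma filterlim_int_filtercomap_abs:
  "filterlim int (filtercomap (\<lambda>j::int. \<bar>j\<bar>) at_top) sequentially"
  unfolding filterlim_filtercomap_iff by (simp add: comp_def filterlim_int_sequentially)

lemma (in abelian_expectation) asymptotic_homomorphism_imp:
  assumes "asymptotic_homomorphism M tr N"
  shows "strongly_singular_masa M tr N" and "popa_delta_one M tr N"
proof -
  obtain u where u: "u \<in> N" "unitary u"
    and lim: "\<And>x y. x \<in> M \<Longrightarrow> y \<in> M \<Longrightarrow>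
      ((\<lambda>j. norm2 tr (cond_exp M tr N (x o\<^sub>L unitary_pow u j o\<^sub>L y)
          - (cond_exp M tr N x o\<^sub>L cond_exp M tr N y o\<^sub>L unitary_pow u j)))
        \<longlongrightarrow> 0) (filtercomap (\<lambda>j::int. \<bar>j\<bar>) at_top)"
    using assms unfolding asymptotic_homomorphism_def Let_def by blast
  have "asymptotically_multiplicative M tr N E (\<lambda>n. unitary_pow u (int n))"
  proof unfold_locales
    fix x y assume xy: "x \<in> M" "y \<in> M"
    then have "x o\<^sub>L unitary_pow u j o\<^sub>L y \<in> M" for j
      using u by (auto simp: sub_in unitary_pow_in)
    with lim[OF xy] have "((\<lambda>j. norm2 tr (E (x o\<^sub>L unitary_pow u j o\<^sub>L y)
        - (E x o\<^sub>L E y o\<^sub>L unitary_pow u j))) \<longlongrightarrow> 0) (filtercomap (\<lambda>j::int. \<bar>j\<bar>) at_top)"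
      using xy by (simp add: cond_exp_eq)
    from filterlim_compose[OF this filterlim_int_filtercomap_abs]
    show "(\<lambda>n. norm2 tr (E (x o\<^sub>L unitary_pow u (int n) o\<^sub>L y)
        - (E x o\<^sub>L E y o\<^sub>L unitary_pow u (int n)))) \<longlonglongrightarrow> 0" .
  qed (use u in \<open>simp_all add: unitary_pow_in unitary_unitary_pow\<close>)
  then interpret asymptotically_multiplicative M tr N E "\<lambda>n. unitary_pow u (int n)" .
  show "strongly_singular_masa M tr N" by (rule strongly_singular)
  show "popa_delta_one M tr N" by (rule popa_delta_one)
qed

section \<open>Orthonormal expansions and the completion\<close>

context traced_algebra
begin

lemma norm2_sum_orthonormal:
  assumes F: "finite F" and e: "\<And>i. i \<in> F \<Longrightarrow> e i \<in> M"
    and orth: "\<And>i j. i \<in> F \<Longrightarrow> j \<in> F \<Longrightarrow> ip (e i) (e j) = (if i = j then 1 else 0)"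
  shows "(norm2 tr (\<Sum>i\<in>F. c i *\<^sub>C e i))\<^sup>2 = (\<Sum>i\<in>F. (cmod (c i))\<^sup>2)"
proof -
  have "ip (\<Sum>i\<in>F. c i *\<^sub>C e i) (\<Sum>j\<in>F. c j *\<^sub>C e j)
      = (\<Sum>i\<in>F. \<Sum>j\<in>F. c i * (cnj (c j) * ip (e i) (e j)))"
    using e by (simp add: ip_sum_left ip_sum_right ip_scaleC_left ip_scaleC_right sum_distrib_left)
      (subst sum.swap, simp add: mult.left_commute)
  also have "\<dots> = (\<Sum>i\<in>F. \<Sum>j\<in>F. if i = j then c i * cnj (c j) else 0)"
    by (intro sum.cong refl) (simp add: orth)
  also have "\<dots> = complex_of_real (\<Sum>i\<in>F. (cmod (c i))\<^sup>2)"
    using F by (simp add: complex_norm_square[symmetric] del: of_real_power)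
  finally show ?thesis
    using e by (simp add: norm2_power2)
qed

lemma norm2_residual:
  assumes F: "finite F" and e: "\<And>i. i \<in> F \<Longrightarrow> e i \<in> M"
    and orth: "\<And>i j. i \<in> F \<Longrightarrow> j \<in> F \<Longrightarrow> ip (e i) (e j) = (if i = j then 1 else 0)"
    and x: "x \<in> M"
  shows "(norm2 tr (x - (\<Sum>i\<in>F. ip x (e i) *\<^sub>C e i)))\<^sup>2
    = (norm2 tr x)\<^sup>2 - (\<Sum>i\<in>F. (cmod (ip x (e i)))\<^sup>2)"
proof -
  have "ip x (\<Sum>i\<in>F. ip x (e i) *\<^sub>C e i) = (\<Sum>i\<in>F. cnj (ip x (e i)) * ip x (e i))"
    using e x by (simp add: ip_sum_right ip_scaleC_right)
  also have "\<dots> = complex_of_real (\<Sum>i\<in>F. (cmod (ip x (e i)))\<^sup>2)"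
    by (simp only: of_real_sum complex_norm_square mult.commute)
  finally show ?thesis
    using e x by (simp add: norm2_diff_power2 norm2_sum_orthonormal[OF F e orth])
qed

lemma bessel:
  assumes "finite F" and "\<And>i. i \<in> F \<Longrightarrow> e i \<in> M"
    and "\<And>i j. i \<in> F \<Longrightarrow> j \<in> F \<Longrightarrow> ip (e i) (e j) = (if i = j then 1 else 0)"
    and "x \<in> M"
  shows "(\<Sum>i\<in>F. (cmod (ip x (e i)))\<^sup>2) \<le> (norm2 tr x)\<^sup>2"
  using norm2_residual[OF assms] zero_le_power2[of "norm2 tr (x - (\<Sum>i\<in>F. ip x (e i) *\<^sub>C e i))"]
  by linarith

lemma L2_cauchy_in: "s \<in> L2_cauchy N tr \<Longrightarrow> s n \<in> N"
  by (auto simp: L2_cauchy_def)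

lemma norm2_diff_cong:
  assumes s: "s \<in> L2_cauchy N tr" and t: "t \<in> L2_cauchy N tr" and N: "N \<subseteq> M"
    and s': "(s, s') \<in> L2_rel N tr" and t': "(t, t') \<in> L2_rel N tr"
    and lim: "(\<lambda>n. norm2 tr (s n - t n)) \<longlonglongrightarrow> r"
  shows "(\<lambda>n. norm2 tr (s' n - t' n)) \<longlonglongrightarrow> r"
proof -
  have in_M: "s n \<in> M" "s' n \<in> M" "t n \<in> M" "t' n \<in> M" for n
  proof -
    have "s' \<in> L2_cauchy N tr" "t' \<in> L2_cauchy N tr"
      using s' t' by (auto simp: L2_rel_def)
    then show "s n \<in> M" "s' n \<in> M" "t n \<in> M" "t' n \<in> M"
      using s t N L2_cauchy_in[of _ N n] by blast+
  qed
  have "(\<lambda>n. norm2 tr (s n - s' n)) \<longlonglongrightarrow> 0" "(\<lambda>n. norm2 tr (t n - t' n)) \<longlonglongrightarrow> 0"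
    using s' t' by (auto simp: L2_rel_def)
  then have "(\<lambda>n. norm2 tr (s n - s' n) + norm2 tr (t n - t' n)) \<longlonglongrightarrow> 0 + 0"
    by (rule tendsto_add)
  then have to0: "(\<lambda>n. norm2 tr (s n - s' n) + norm2 tr (t n - t' n)) \<longlonglongrightarrow> 0"
    by simp
  have "norm (norm2 tr (s' n - t' n) - norm2 tr (s n - t n))
      \<le> norm2 tr (s n - s' n) + norm2 tr (t n - t' n)" for n
    using norm2_dist_triangle[of "s' n" "s n" "t' n"] norm2_dist_triangle[of "s n" "t n" "t' n"]
      norm2_dist_triangle[of "s n" "s' n" "t n"] norm2_dist_triangle[of "s' n" "t' n" "t n"]
      norm2_minus_commute[of "s n" "s' n"] norm2_minus_commute[of "t n" "t' n"] in_M[of n]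
    by simp
  then have "(\<lambda>n. norm2 tr (s' n - t' n) - norm2 tr (s n - t n)) \<longlonglongrightarrow> 0"
    by (rule Lim_null_comparison[OF eventuallyI to0])
  from tendsto_add[OF this lim] show ?thesis by simp
qed

text \<open>The limit does not depend on the chosen representatives, which makes \<^const>\<open>L2_dist\<close> well
  defined and computable from any Cauchy sequences.\<close>

lemma L2_dist_class:
  assumes s: "s \<in> L2_cauchy N tr" and t: "t \<in> L2_cauchy N tr" and N: "N \<subseteq> M"
    and lim: "(\<lambda>n. norm2 tr (s n - t n)) \<longlonglongrightarrow> r"
  shows "L2_dist tr (L2_rel N tr `` {s}) (L2_rel N tr `` {t}) = r"
  unfolding L2_dist_def
proof (rule the_equality)
  show "\<forall>s'\<in>L2_rel N tr `` {s}. \<forall>t'\<in>L2_rel N tr `` {t}. (\<lambda>n. norm2 tr (s' n - t' n)) \<longlonglongrightarrow> r"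
    using norm2_diff_cong[OF s t N _ _ lim] by blast
  have refl: "(s, s) \<in> L2_rel N tr" "(t, t) \<in> L2_rel N tr"
    using s t by (auto simp: L2_rel_def)
  show "r' = r"
    if "\<forall>s'\<in>L2_rel N tr `` {s}. \<forall>t'\<in>L2_rel N tr `` {t}. (\<lambda>n. norm2 tr (s' n - t' n)) \<longlonglongrightarrow> r'"
    for r'
    using that refl lim LIMSEQ_unique by blast
qed

lemma const_L2_cauchy: "x \<in> N \<Longrightarrow> (\<lambda>_. x) \<in> L2_cauchy N tr"
  by (simp add: L2_cauchy_def)

lemma class_in_L2: "s \<in> L2_cauchy N tr \<Longrightarrow> L2_rel N tr `` {s} \<in> L2 N tr"
  by (auto simp: L2_def intro: quotientI)

lemma L2_embed_in_L2: "x \<in> N \<Longrightarrow> L2_embed N tr x \<in> L2 N tr"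
  unfolding L2_embed_def by (intro class_in_L2 const_L2_cauchy)

lemma L2_dist_embed:
  assumes "x \<in> N" "y \<in> N" "N \<subseteq> M"
  shows "L2_dist tr (L2_embed N tr x) (L2_embed N tr y) = norm2 tr (x - y)"
  unfolding L2_embed_def using assms by (intro L2_dist_class const_L2_cauchy) auto

lemma L2_denseD:
  assumes "L2_dense N tr Z" "N \<subseteq> M" "x \<in> N" "0 < \<epsilon>"
  obtains z where "z \<in> Z" "norm2 tr (x - z) < \<epsilon>"
proof -
  from assms L2_embed_in_L2[OF assms(3)]
  obtain z where z: "z \<in> Z" "L2_dist tr (L2_embed N tr x) (L2_embed N tr z) < \<epsilon>"
    unfolding L2_dense_def by blast
  moreover have "z \<in> N"
    using z assms by (auto simp: L2_dense_def)
  ultimately show thesis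
    using that L2_dist_embed[of x N z] assms by simp
qed

end

locale L2_basis = traced_algebra +
  fixes N and v :: "nat \<Rightarrow> 'a op"
  assumes sub: "star_subalgebra N M"
    and id_sub: "id_blinfun \<in> N"
    and basis: "L2_orthonormal_basis N tr v"
begin

lemma sub_in: "x \<in> N \<Longrightarrow> x \<in> M"
  by (rule star_subalgebra_in[OF sub])

lemma v_in: "v n \<in> N"
  using basis by (auto simp: L2_orthonormal_basis_def)

lemma v_in_M [simp, intro]: "v n \<in> M"
  by (simp add: sub_in v_in)

lemma v_orth: "ip (v m) (v n) = (if m = n then 1 else 0)"
  using basis by (simp add: L2_orthonormal_basis_def ip_def)

definition expansion :: "nat \<Rightarrow> 'a op \<Rightarrow> 'a op" where
  "expansion k x = (\<Sum>n<k. ip x (v n) *\<^sub>C v n)"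

lemma expansion_in: "expansion k x \<in> N"
  unfolding expansion_def
  by (intro star_subalgebra_sum[OF sub] star_subalgebra_scaleC[OF sub] v_in)

lemma expansion_in_M [simp, intro]: "expansion k x \<in> M"
  by (simp add: sub_in expansion_in)

lemma expansion_diff:
  "x \<in> M \<Longrightarrow> y \<in> M \<Longrightarrow> expansion k (x - y) = expansion k x - expansion k y"
  by (simp add: expansion_def ip_diff_left complex_vector.scale_left_diff_distrib sum_subtractf)

lemma norm2_expansion_residual_le: "x \<in> M \<Longrightarrow> norm2 tr (x - expansion k x) \<le> norm2 tr x"
proof (rule power2_le_imp_le)
  assume x: "x \<in> M"
  have "0 \<le> (\<Sum>i<k. (cmod (ip x (v i)))\<^sup>2)"
    by (intro sum_nonneg) simp
  then show "(norm2 tr (x - expansion k x))\<^sup>2 \<le> (norm2 tr x)\<^sup>2"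
    unfolding expansion_def using x by (subst norm2_residual) (auto simp: v_orth)
qed simp

text \<open>On the span of the basis the expansion is eventually exact; density and the fact that the
  residual is a contraction extend this to convergence on all of \<open>N\<close>.\<close>

lemma span_expansion:
  assumes "z \<in> complex_vector.span (range v)"
  shows "z \<in> N \<and> (\<exists>K. \<forall>k\<ge>K. expansion k z = z)"
  using assms
proof (induction rule: complex_vector.span_induct_alt)
  case base
  show ?case
    using star_subalgebra_zero[OF sub] by (auto simp: expansion_def)
next
  case (step c x y)
  then obtain m K where x: "x = v m" and y: "y \<in> N" "\<And>k. k \<ge> K \<Longrightarrow> expansion k y = y"
    by blast
  have "expansion k (c *\<^sub>C x + y) = c *\<^sub>C x + y" if k: "k \<ge> max K (Suc m)" for k
  proof -
    have "expansion k (c *\<^sub>C x + y) = (\<Sum>n<k. (c * ip x (v n)) *\<^sub>C v n) + expansion k y"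
      using y(1) by (simp add: x expansion_def ip_add_left ip_scaleC_left sub_in scaleC_add_left
          sum.distrib)
    also have "(\<Sum>n<k. (c * ip x (v n)) *\<^sub>C v n) = (\<Sum>n<k. if m = n then c *\<^sub>C v n else 0)"
      by (intro sum.cong) (auto simp: x v_orth)
    also have "\<dots> = c *\<^sub>C x"
      using k by (simp add: x)
    finally show ?thesis
      using y(2) k by simp
  qed
  moreover have "c *\<^sub>C x + y \<in> N"
    unfolding x by (intro star_subalgebra_add[OF sub] star_subalgebra_scaleC[OF sub] v_in y(1))
  ultimately show ?case
    by blast
qed

lemma expansion_limit:
  assumes x: "x \<in> N"
  shows "(\<lambda>k. norm2 tr (x - expansion k x)) \<longlonglongrightarrow> 0"
proof (rule LIMSEQ_I)
  fix e :: real
  assume e: "0 < e"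
  have "L2_dense N tr (complex_vector.span (range v))"
    using basis by (simp add: L2_orthonormal_basis_def)
  then obtain z where z: "z \<in> complex_vector.span (range v)" and d: "norm2 tr (x - z) < e"
    using L2_denseD[OF _ _ x e] sub_in by blast
  from span_expansion[OF z] obtain K
    where zN: "z \<in> N" and K: "\<And>k. k \<ge> K \<Longrightarrow> expansion k z = z" by blast
  show "\<exists>K. \<forall>k\<ge>K. norm (norm2 tr (x - expansion k x) - 0) < e"
  proof (intro exI allI impI)
    fix k assume k: "K \<le> k"
    have "x - expansion k x = (x - z) - expansion k (x - z)"
      using x zN K[OF k] by (simp add: expansion_diff sub_in)
    then have "norm2 tr (x - expansion k x) = norm2 tr ((x - z) - expansion k (x - z))"
      by (rule arg_cong)
    also have "\<dots> \<le> norm2 tr (x - z)"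
      using x zN by (intro norm2_expansion_residual_le) (simp add: sub_in)
    finally have "norm2 tr (x - expansion k x) \<le> norm2 tr (x - z)" .
    then show "norm (norm2 tr (x - expansion k x) - 0) < e"
      using d x by (simp add: sub_in)
  qed
qed

text \<open>By Bessel's inequality the coefficients of any \<open>x \<in> M\<close> are square summable; the limit of the
  partial sums in \<open>L\<^sup>2(N)\<close> is the orthogonal projection of \<open>x\<close>.\<close>

lemma expansion_Cauchy:
  assumes x: "x \<in> M"
  shows "(\<lambda>k. expansion k x) \<in> L2_cauchy N tr"
  unfolding L2_cauchy_def
proof (intro CollectI conjI allI impI)
  show "range (\<lambda>k. expansion k x) \<subseteq> N"
    using expansion_in by blast
  fix e :: real
  assume e: "0 < e"
  let ?c = "\<lambda>n. (cmod (ip x (v n)))\<^sup>2"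
  have "summable ?c"
  proof (rule summableI_nonneg_bounded)
    show "(\<Sum>i<n. ?c i) \<le> (norm2 tr x)\<^sup>2" for n
      by (rule bessel) (simp_all add: v_orth x)
  qed simp
  then obtain K where K: "\<And>m n. m \<ge> K \<Longrightarrow> norm (sum ?c {m..<n}) < e\<^sup>2"
    unfolding summable_Cauchy using zero_less_power[OF e, of 2] by meson
  have *: "norm2 tr (expansion n x - expansion m x) < e" if "K \<le> m" "m \<le> n" for m n
  proof -
    have "expansion n x - expansion m x = (\<Sum>i\<in>{m..<n}. ip x (v i) *\<^sub>C v i)"
      using sum_diff_nat_ivl[of 0 m n "\<lambda>i. ip x (v i) *\<^sub>C v i"] that
      by (simp add: expansion_def lessThan_atLeast0)
    then have "(norm2 tr (expansion n x - expansion m x))\<^sup>2 = sum ?c {m..<n}"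
      using norm2_sum_orthonormal[of "{m..<n}" v] by (simp add: v_orth)
    also have "\<dots> < e\<^sup>2"
      using K[OF that(1), of n] by simp
    finally show ?thesis
      by (rule power_less_imp_less_base) (use e in simp)
  qed
  show "\<exists>k. \<forall>m\<ge>k. \<forall>n\<ge>k. norm2 tr (expansion m x - expansion n x) < e"
  proof (intro exI allI impI)
    fix m n assume "K \<le> m" "K \<le> n"
    then show "norm2 tr (expansion m x - expansion n x) < e"
      using *[of m n] *[of n m] norm2_minus_commute[of "expansion m x" "expansion n x"]
      by (cases "m \<le> n") auto
  qed
qed

lemma ip_expansion_limit:
  assumes x: "x \<in> M" and b: "b \<in> N"
  shows "(\<lambda>k. ip (expansion k x) b) \<longlonglongrightarrow> ip x b"
proof -
  have sym: "ip (expansion k x) b = ip x (expansion k b)" for k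
  proof -
    have "ip b (v n) = cnj (ip (v n) b)" for n
      using b by (intro ip_commute) (auto simp: sub_in)
    then show ?thesis
      using x b by (simp add: expansion_def ip_sum_left ip_sum_right ip_scaleC_left ip_scaleC_right
          sub_in mult.commute)
  qed
  have "norm (ip x (expansion k b) - ip x b) \<le> norm2 tr x * norm2 tr (b - expansion k b)" for k
    using cauchy_schwarz[of x "expansion k b - b"] x b norm2_minus_commute[of b "expansion k b"]
    by (simp add: ip_diff_right sub_in)
  moreover have "(\<lambda>k. norm2 tr x * norm2 tr (b - expansion k b)) \<longlonglongrightarrow> 0"
    using tendsto_mult_left[OF expansion_limit[OF b], of "norm2 tr x"] by simp
  ultimately have "(\<lambda>k. ip x (expansion k b) - ip x b) \<longlonglongrightarrow> 0"
    by (rule Lim_null_comparison[OF eventuallyI])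
  then show ?thesis
    unfolding sym by (simp add: LIM_zero_iff)
qed

end

section \<open>The conditional expectation onto a copy of \<open>L\<^sup>\<infinity>[0,1]\<close>\<close>

interpretation unit_interval: finite_measure unit_interval
  by (rule finite_measure_lebesgue_on) simp

lemma measure_unit_interval: "measure unit_interval {0..1} = 1"
  by (simp add: measure_restrict_space)

lemma integrable_unit_interval:
  assumes "f \<in> borel_measurable unit_interval" "integrable unit_interval (\<lambda>t. (cmod (f t))\<^sup>2)"
  shows "integrable unit_interval f"
proof -
  have "integrable unit_interval (\<lambda>t. cmod (f t))"
    by (rule unit_interval.square_integrable_imp_integrable) (use assms in auto)
  then show ?thesis
    using integrable_norm_iff[OF assms(1)] by blast
qed

lemma norm_integral_le_L2:
  assumes f: "f \<in> borel_measurable unit_interval"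
    and sq: "integrable unit_interval (\<lambda>t. (cmod (f t))\<^sup>2)"
  shows "cmod (LINT t|unit_interval. f t) \<le> sqrt (LINT t|unit_interval. (cmod (f t))\<^sup>2)"
proof -
  define m where "m = (LINT t|unit_interval. cmod (f t))"
  have int: "integrable unit_interval (\<lambda>t. cmod (f t))"
    using integrable_unit_interval[OF f sq] by simp
  have "0 \<le> (LINT t|unit_interval. (cmod (f t) - m)\<^sup>2)"
    by (intro integral_nonneg_AE) simp
  also have "\<dots> = (LINT t|unit_interval. (cmod (f t))\<^sup>2 - 2 * m * cmod (f t) + m\<^sup>2)"
    by (simp add: power2_diff algebra_simps)
  also have "\<dots> = (LINT t|unit_interval. (cmod (f t))\<^sup>2) - 2 * m * m + m\<^sup>2"
    using int sq by (simp add: m_def measure_unit_interval)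
  finally have "m \<le> sqrt (LINT t|unit_interval. (cmod (f t))\<^sup>2)"
    by (intro real_le_rsqrt) (simp add: power2_eq_square)
  then show ?thesis
    using integral_norm_bound[of unit_interval f] unfolding m_def by (rule order_trans[rotated])
qed

lemma integrable_square_diff:
  assumes "f \<in> borel_measurable unit_interval" "integrable unit_interval (\<lambda>t. (cmod (f t))\<^sup>2)"
    and "g \<in> borel_measurable unit_interval" "integrable unit_interval (\<lambda>t. (cmod (g t))\<^sup>2)"
  shows "integrable unit_interval (\<lambda>t. (cmod (f t - g t))\<^sup>2)"
proof (rule Bochner_Integration.integrable_bound)
  show "integrable unit_interval (\<lambda>t. 2 * (cmod (f t))\<^sup>2 + 2 * (cmod (g t))\<^sup>2)"
    using assms by simp
  have "(cmod (a - b))\<^sup>2 \<le> 2 * (cmod a)\<^sup>2 + 2 * (cmod b)\<^sup>2" for a b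
  proof -
    have "(cmod (a - b))\<^sup>2 \<le> (cmod a + cmod b)\<^sup>2"
      by (intro power_mono norm_triangle_ineq4) simp
    also have "\<dots> \<le> (cmod a + cmod b)\<^sup>2 + (cmod a - cmod b)\<^sup>2"
      by simp
    also have "\<dots> = 2 * (cmod a)\<^sup>2 + 2 * (cmod b)\<^sup>2"
      by (simp add: power2_eq_square algebra_simps)
    finally show ?thesis .
  qed
  then show "AE t in unit_interval. norm ((cmod (f t - g t))\<^sup>2)
      \<le> norm (2 * (cmod (f t))\<^sup>2 + 2 * (cmod (g t))\<^sup>2)"
    by simp
qed (use assms in measurable)

lemma ae_class_self: "f \<in> borel_measurable unit_interval \<Longrightarrow> f \<in> ae_class f"
  by (simp add: ae_class_def)

lemma ae_class_eq:
  assumes "g \<in> ae_class f"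
  shows "ae_class g = ae_class f"
proof -
  have *: "AE t in unit_interval. f t = g t"
    using assms by (simp add: ae_class_def)
  have "(AE t in unit_interval. g t = h t) \<longleftrightarrow> (AE t in unit_interval. f t = h t)" for h
    using * by (auto elim: eventually_elim2)
  then show ?thesis
    by (simp add: ae_class_def)
qed

text \<open>The members of \<open>\<pi> a\<close> are the functions representing \<open>a\<close>, so \<open>f \<in> \<pi> a\<close> says that \<open>f\<close> is one
  of them.\<close>

locale Linf_model = L2_basis +
  fixes \<pi> :: "'a op \<Rightarrow> (real \<Rightarrow> complex) set"
  assumes iso: "star_isomorphism_Linf N \<pi>"
    and isometry: "induces_L2_isometry N tr \<pi>"
begin

lemma model_class:
  assumes "a \<in> N" "f \<in> \<pi> a"
  shows model_eq: "\<pi> a = ae_class f"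
    and model_measurable: "f \<in> borel_measurable unit_interval"
    and model_bounded: "\<exists>C. AE t in unit_interval. cmod (f t) \<le> C"
proof -
  have "\<pi> a \<in> Linf_01"
    using iso assms by (auto simp: star_isomorphism_Linf_def bij_betw_def)
  then obtain g C where g: "\<pi> a = ae_class g" "g \<in> borel_measurable unit_interval"
    and C: "AE t in unit_interval. cmod (g t) \<le> C"
    by (auto simp: Linf_01_def)
  show "\<pi> a = ae_class f"
    using ae_class_eq[of f g] g assms by simp
  show "f \<in> borel_measurable unit_interval"
    using g assms by (simp add: ae_class_def)
  have "AE t in unit_interval. g t = f t"
    using g assms by (simp add: ae_class_def)
  with C have "AE t in unit_interval. cmod (f t) \<le> C"
    by (auto elim: eventually_elim2)
  then show "\<exists>C. AE t in unit_interval. cmod (f t) \<le> C" ..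
qed

lemma model_ex: "a \<in> N \<Longrightarrow> \<exists>f. f \<in> \<pi> a"
proof -
  assume "a \<in> N"
  then have "\<pi> a \<in> Linf_01"
    using iso by (auto simp: star_isomorphism_Linf_def bij_betw_def)
  then show ?thesis
    by (auto simp: Linf_01_def intro: ae_class_self)
qed

lemma model_surj:
  assumes "f \<in> borel_measurable unit_interval" "AE t in unit_interval. cmod (f t) \<le> C"
  obtains a where "a \<in> N" "\<pi> a = ae_class f" "f \<in> \<pi> a"
proof -
  have "ae_class f \<in> Linf_01"
    using assms by (auto simp: Linf_01_def)
  moreover have "\<pi> ` N = Linf_01"
    using iso by (simp add: star_isomorphism_Linf_def bij_betw_def)
  ultimately obtain a where "a \<in> N" "\<pi> a = ae_class f"
    by (metis imageE)
  then show thesis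
    using that ae_class_self[OF assms(1)] by blast
qed

lemma model_inj: "a \<in> N \<Longrightarrow> b \<in> N \<Longrightarrow> f \<in> \<pi> a \<Longrightarrow> f \<in> \<pi> b \<Longrightarrow> a = b"
  using model_eq[of a f] model_eq[of b f] iso
  by (auto simp: star_isomorphism_Linf_def bij_betw_def inj_on_def)

lemma model_cong:
  assumes "a \<in> N" "f \<in> \<pi> a" "g \<in> borel_measurable unit_interval"
    "AE t in unit_interval. f t = g t"
  shows "g \<in> \<pi> a"
  using model_eq[OF assms(1,2)] assms(3,4) by (simp add: ae_class_def)

lemma
  assumes "a \<in> N" "f \<in> \<pi> a"
  shows model_add: "b \<in> N \<Longrightarrow> g \<in> \<pi> b \<Longrightarrow> (\<lambda>t. f t + g t) \<in> \<pi> (a + b)"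
    and model_mult: "b \<in> N \<Longrightarrow> g \<in> \<pi> b \<Longrightarrow> (\<lambda>t. f t * g t) \<in> \<pi> (a o\<^sub>L b)"
    and model_scaleC: "(\<lambda>t. c * f t) \<in> \<pi> (c *\<^sub>C a)"
    and model_adj: "(\<lambda>t. cnj (f t)) \<in> \<pi> (adj a)"
  using assms iso by (simp_all add: star_isomorphism_Linf_def)

lemma model_zero: "(\<lambda>t. 0) \<in> \<pi> 0"
proof -
  obtain f where "f \<in> \<pi> 0"
    using model_ex[OF star_subalgebra_zero[OF sub]] by blast
  from model_scaleC[OF star_subalgebra_zero[OF sub] this, of 0] show ?thesis by simp
qed

text \<open>The preimage of the constant function 1 is a unit of \<open>N\<close>.\<close>

lemma model_one: "(\<lambda>t. 1) \<in> \<pi> id_blinfun"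
proof -
  obtain e where e: "e \<in> N" "(\<lambda>t. 1) \<in> \<pi> e"
    by (rule model_surj[of "\<lambda>t. 1" 1]) auto
  obtain f where f: "f \<in> \<pi> id_blinfun"
    using model_ex[OF id_sub] by blast
  from model_mult[OF id_sub f e] have "f \<in> \<pi> e"
    by simp
  then have "e = id_blinfun"
    using model_inj[OF e(1) id_sub _ f] by simp
  then show ?thesis using e by simp
qed

lemma model_square_integrable:
  assumes "a \<in> N" "f \<in> \<pi> a"
  shows "integrable unit_interval (\<lambda>t. (cmod (f t))\<^sup>2)"
proof -
  obtain C where "AE t in unit_interval. cmod (f t) \<le> C"
    using model_bounded[OF assms] by blast
  then have "AE t in unit_interval. norm ((cmod (f t))\<^sup>2) \<le> C\<^sup>2"
    by eventually_elim (simp add: power_mono)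
  then show ?thesis
    using model_measurable[OF assms] by (intro unit_interval.integrable_const_bound) measurable
qed

lemma model_integrable: "a \<in> N \<Longrightarrow> f \<in> \<pi> a \<Longrightarrow> integrable unit_interval f"
  by (intro integrable_unit_interval model_measurable model_square_integrable)

lemma sub_subset: "N \<subseteq> M"
  using sub_in by blast

lemma L2_cauchy_tail:
  "s \<in> L2_cauchy N tr \<Longrightarrow> 0 < e \<Longrightarrow> \<exists>K. \<forall>m\<ge>K. \<forall>n\<ge>K. norm2 tr (s m - s n) < e"
  by (simp add: L2_cauchy_def)

lemma L2_extension:
  obtains U where "U ` L2 N tr = L2_01"
    and "\<And>\<xi> \<eta> f g. \<xi> \<in> L2 N tr \<Longrightarrow> \<eta> \<in> L2 N tr \<Longrightarrow> f \<in> U \<xi> \<Longrightarrow> g \<in> U \<eta> \<Longrightarrow>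
      sqrt (LINT t|unit_interval. (cmod (f t - g t))\<^sup>2) = L2_dist tr \<xi> \<eta>"
    and "\<And>a. a \<in> N \<Longrightarrow> U (L2_embed N tr a) = \<pi> a"
proof -
  from isometry[unfolded induces_L2_isometry_def]
  obtain U where U: "U ` L2 N tr = L2_01 \<and>
      (\<forall>\<xi>\<in>L2 N tr. \<forall>\<eta>\<in>L2 N tr. \<forall>f\<in>U \<xi>. \<forall>g\<in>U \<eta>.
         sqrt (LINT t|unit_interval. (cmod (f t - g t))\<^sup>2) = L2_dist tr \<xi> \<eta>) \<and>
      (\<forall>a\<in>N. U (L2_embed N tr a) = \<pi> a)"
    by (rule exE)
  show thesis
    by (rule that[of U]) (simp_all add: U)
qed

text \<open>The completion of \<open>N\<close> is realised by square integrable functions: a Cauchy sequence in \<open>N\<close>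
  has a limit \<open>f\<close> in \<open>L\<^sup>2[0,1]\<close>, characterised by its distances to the elements of \<open>N\<close>.\<close>

lemma L2_element:
  assumes s: "s \<in> L2_cauchy N tr"
  obtains f where "f \<in> borel_measurable unit_interval"
    and "integrable unit_interval (\<lambda>t. (cmod (f t))\<^sup>2)"
    and "\<And>a g. a \<in> N \<Longrightarrow> g \<in> \<pi> a \<Longrightarrow>
      (\<lambda>k. norm2 tr (s k - a)) \<longlonglongrightarrow> sqrt (LINT t|unit_interval. (cmod (f t - g t))\<^sup>2)"
proof (rule L2_extension)
  let ?\<xi> = "L2_rel N tr `` {s}"
  fix U
  assume U: "U ` L2 N tr = L2_01"
    and dist: "\<And>\<xi> \<eta> f g. \<xi> \<in> L2 N tr \<Longrightarrow> \<eta> \<in> L2 N tr \<Longrightarrow> f \<in> U \<xi> \<Longrightarrow> g \<in> U \<eta> \<Longrightarrow>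
      sqrt (LINT t|unit_interval. (cmod (f t - g t))\<^sup>2) = L2_dist tr \<xi> \<eta>"
    and ext: "\<And>a. a \<in> N \<Longrightarrow> U (L2_embed N tr a) = \<pi> a"
  have \<xi>: "?\<xi> \<in> L2 N tr"
    using s by (rule class_in_L2)
  then have "U ?\<xi> \<in> L2_01"
    using U by blast
  then obtain f where f: "U ?\<xi> = ae_class f" "f \<in> borel_measurable unit_interval"
    "integrable unit_interval (\<lambda>t. (cmod (f t))\<^sup>2)"
    by (auto simp: L2_01_def)
  show thesis
  proof (rule that[OF f(2,3)])
    fix a g assume a: "a \<in> N" and g: "g \<in> \<pi> a"
    have "Cauchy (\<lambda>k. norm2 tr (s k - a))"
    proof (rule CauchyI)
      fix e :: real assume "0 < e"
      then obtain K where K: "\<And>m n. K \<le> m \<Longrightarrow> K \<le> n \<Longrightarrow> norm2 tr (s m - s n) < e"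
        using L2_cauchy_tail[OF s] by meson
      show "\<exists>K. \<forall>m\<ge>K. \<forall>n\<ge>K. norm (norm2 tr (s m - a) - norm2 tr (s n - a)) < e"
      proof (intro exI allI impI)
        fix m n assume mn: "K \<le> m" "K \<le> n"
        have "s m \<in> M" "s n \<in> M" "a \<in> M"
          using a L2_cauchy_in[OF s] by (simp_all add: sub_in)
        then show "norm (norm2 tr (s m - a) - norm2 tr (s n - a)) < e"
          using norm2_dist_triangle[of "s m" "s n" a] norm2_dist_triangle[of "s n" "s m" a]
            K[OF mn] K[OF mn(2,1)] by simp
      qed
    qed
    then obtain r where r: "(\<lambda>k. norm2 tr (s k - a)) \<longlonglongrightarrow> r"
      using Cauchy_convergent convergent_def by blast
    have "L2_dist tr ?\<xi> (L2_embed N tr a) = r"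
      unfolding L2_embed_def using s const_L2_cauchy[OF a] sub_in r
      by (intro L2_dist_class) auto
    moreover have "sqrt (LINT t|unit_interval. (cmod (f t - g t))\<^sup>2) = L2_dist tr ?\<xi> (L2_embed N tr a)"
      using dist[OF \<xi> L2_embed_in_L2[OF a], of f g] f ext[OF a] g ae_class_self by simp
    ultimately show "(\<lambda>k. norm2 tr (s k - a)) \<longlonglongrightarrow> sqrt (LINT t|unit_interval. (cmod (f t - g t))\<^sup>2)"
      using r by simp
  qed
qed

lemma norm2_model:
  assumes "a \<in> N" "f \<in> \<pi> a"
  shows "(norm2 tr a)\<^sup>2 = (LINT t|unit_interval. (cmod (f t))\<^sup>2)"
proof (rule L2_extension)
  fix U
  assume "U ` L2 N tr = L2_01"
    and dist: "\<And>\<xi> \<eta> f g. \<xi> \<in> L2 N tr \<Longrightarrow> \<eta> \<in> L2 N tr \<Longrightarrow> f \<in> U \<xi> \<Longrightarrow> g \<in> U \<eta> \<Longrightarrow>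
      sqrt (LINT t|unit_interval. (cmod (f t - g t))\<^sup>2) = L2_dist tr \<xi> \<eta>"
    and ext: "\<And>a. a \<in> N \<Longrightarrow> U (L2_embed N tr a) = \<pi> a"
  have "norm2 tr (a - 0) = sqrt (LINT t|unit_interval. (cmod (f t - 0))\<^sup>2)"
    using dist[of "L2_embed N tr a" "L2_embed N tr 0" f "\<lambda>t. 0"] assms model_zero
      star_subalgebra_zero[OF sub] ext L2_dist_embed[OF _ _ sub_subset, of a 0] L2_embed_in_L2
    by simp
  moreover have "0 \<le> (LINT t|unit_interval. (cmod (f t))\<^sup>2)"
    by (intro integral_nonneg_AE) simp
  ultimately show ?thesis by simp
qed

text \<open>The isometry determines the trace by polarisation against the unit.\<close>

lemma tr_model:
  assumes a: "a \<in> N" and f: "f \<in> \<pi> a"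
  shows "tr a = (LINT t|unit_interval. f t)"
proof -
  have re: "Re (tr b) = Re (LINT t|unit_interval. g t)" if b: "b \<in> N" and g: "g \<in> \<pi> b" for b g
  proof -
    have int: "integrable unit_interval g" "integrable unit_interval (\<lambda>t. (cmod (g t))\<^sup>2)"
      using b g by (auto intro: model_integrable model_square_integrable)
    have expand: "(cmod (z + 1))\<^sup>2 = (cmod z)\<^sup>2 + 2 * Re z + 1" for z
      unfolding cmod_power2 by (simp add: power2_eq_square algebra_simps)
    have "(norm2 tr (b + id_blinfun))\<^sup>2 = (LINT t|unit_interval. (cmod (g t + 1))\<^sup>2)"
      using b g by (intro norm2_model model_add model_one star_subalgebra_add[OF sub] id_sub)
    also have "\<dots> = (LINT t|unit_interval. (cmod (g t))\<^sup>2) + 2 * Re (LINT t|unit_interval. g t) + 1"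
      using int unfolding expand by (simp add: measure_unit_interval)
    finally show ?thesis
      using norm2_add_power2[of b id_blinfun] norm2_model[OF b g] b
      by (simp add: sub_in norm2_id ip_def)
  qed
  have "Re (tr (\<i> *\<^sub>C a)) = Re (LINT t|unit_interval. \<i> * f t)"
    using a f by (intro re model_scaleC star_subalgebra_scaleC[OF sub])
  then show ?thesis
    using re[OF a f] a by (simp add: complex_eq_iff tr_scaleC sub_in)
qed

lemma ip_model:
  assumes "a \<in> N" "f \<in> \<pi> a" "b \<in> N" "g \<in> \<pi> b"
  shows "ip a b = (LINT t|unit_interval. cnj (g t) * f t)"
  unfolding ip_def using assms
  by (intro tr_model model_mult model_adj star_subalgebra_compose[OF sub] star_subalgebra_adj[OF sub])

text \<open>Characteristic functions correspond to projections, which test elements of \<open>N\<close> on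
  measurable sets.\<close>

lemma model_indicator:
  assumes S: "S \<in> sets unit_interval"
  obtains p where "p \<in> N" "(\<lambda>t. of_real (indicat_real S t)) \<in> \<pi> p" "adj p = p" "p o\<^sub>L p = p"
    "(norm2 tr p)\<^sup>2 = measure unit_interval S"
proof -
  let ?\<chi> = "\<lambda>t. complex_of_real (indicat_real S t)"
  have m: "?\<chi> \<in> borel_measurable unit_interval"
    using S by measurable
  obtain p where p: "p \<in> N" "?\<chi> \<in> \<pi> p"
    by (rule model_surj[OF m, of 1]) (auto simp: indicator_def)
  have "adj p = p"
    using model_adj[OF p] p star_subalgebra_adj[OF sub] by (intro model_inj[of _ _ ?\<chi>]) auto
  moreover have "(\<lambda>t. ?\<chi> t * ?\<chi> t) = ?\<chi>"
    by (auto simp: indicator_def)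
  then have "p o\<^sub>L p = p"
    using model_mult[OF p p] p star_subalgebra_compose[OF sub] by (intro model_inj[of _ _ ?\<chi>]) auto
  moreover have "(\<lambda>t. (cmod (?\<chi> t))\<^sup>2) = indicat_real S"
    by (auto simp: indicator_def)
  then have "(norm2 tr p)\<^sup>2 = measure unit_interval S"
    using norm2_model[OF p] S sets.sets_into_space[OF S] by (simp add: Int_absorb2)
  ultimately show thesis
    using that p by blast
qed

lemma ip_sandwich:
  assumes "p \<in> N" "adj p = p" "p o\<^sub>L p = p" "x \<in> M"
  shows "ip x p = tr (adj p o\<^sub>L x o\<^sub>L p)"
proof -
  have "tr (p o\<^sub>L x o\<^sub>L p) = tr (p o\<^sub>L (p o\<^sub>L x))"
    using assms by (intro tr_commute) (auto simp: sub_in)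
  then show ?thesis
    using assms by (simp add: ip_def compose_assoc[symmetric])
qed

text \<open>The limit \<open>f\<close> of the expansion of \<open>x\<close> in \<open>L\<^sup>2[0,1]\<close> satisfies \<open>\<bar>\<integral>\<^sub>S f\<bar> = \<bar>tr (p\<^sub>S x p\<^sub>S)\<bar> \<le> \<parallel>x\<parallel> \<bar>S\<bar>\<close>
  for every measurable \<open>S\<close>, so its averages, hence its values, are bounded by \<open>\<parallel>x\<parallel>\<close>. Thus
  \<open>f\<close> lies in \<open>L\<^sup>\<infinity>[0,1]\<close> and defines an element of \<open>N\<close>.\<close>

lemma ex_projection:
  assumes x: "x \<in> M"
  obtains a where "a \<in> N" "\<And>b. b \<in> N \<Longrightarrow> ip a b = ip x b"
proof -
  let ?s = "\<lambda>k. expansion k x"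
  have s: "?s \<in> L2_cauchy N tr"
    using x by (rule expansion_Cauchy)
  obtain f where f: "f \<in> borel_measurable unit_interval"
    "integrable unit_interval (\<lambda>t. (cmod (f t))\<^sup>2)"
    and lim: "\<And>a g. a \<in> N \<Longrightarrow> g \<in> \<pi> a \<Longrightarrow>
      (\<lambda>k. norm2 tr (?s k - a)) \<longlonglongrightarrow> sqrt (LINT t|unit_interval. (cmod (f t - g t))\<^sup>2)"
    using L2_element[OF s] by blast
  have int_f: "integrable unit_interval f"
    using f by (rule integrable_unit_interval)
  have "\<forall>k. \<exists>h. h \<in> \<pi> (?s k)"
    by (simp add: model_ex expansion_in)
  from choice[OF this] obtain g where "\<forall>k. g k \<in> \<pi> (?s k)" ..
  then have g: "g k \<in> \<pi> (?s k)" for k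
    by simp
  define d where "d k = sqrt (LINT t|unit_interval. (cmod (f t - g k t))\<^sup>2)" for k
  have d_lim: "d \<longlonglongrightarrow> 0"
  proof (rule LIMSEQ_I)
    fix e :: real assume e: "0 < e"
    then obtain K where K: "\<And>m n. K \<le> m \<Longrightarrow> K \<le> n \<Longrightarrow> norm2 tr (?s m - ?s n) < e / 2"
      using L2_cauchy_tail[OF s half_gt_zero[OF e]] by meson
    have "norm (d n - 0) < e" if "K \<le> n" for n
    proof -
      have "d n \<le> e / 2"
        using lim[OF expansion_in g, of n] K[OF _ that] unfolding d_def
        by (intro LIMSEQ_le_const2[of _ _ "e / 2"]) (auto intro: less_imp_le)
      moreover have "0 \<le> d n"
        by (simp add: d_def integral_nonneg_AE)
      ultimately show ?thesis
        using e by simp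
    qed
    then show "\<exists>K. \<forall>n\<ge>K. norm (d n - 0) < e" by blast
  qed
  \<comment> \<open>Testing on the projection \<open>p\<close> of \<open>S\<close> and passing to the limit identifies \<open>\<integral>\<^sub>S f\<close>.\<close>
  have average: "(LINT t|unit_interval. of_real (indicat_real S t) * f t) = ip x p"
    if S: "S \<in> sets unit_interval" and p: "p \<in> N" "(\<lambda>t. of_real (indicat_real S t)) \<in> \<pi> p" for S p
  proof -
    let ?\<chi> = "\<lambda>t. complex_of_real (indicat_real S t)"
    have "(\<lambda>k. LINT t|unit_interval. ?\<chi> t * g k t) \<longlonglongrightarrow> (LINT t|unit_interval. ?\<chi> t * f t)"
    proof (rule LIM_zero_cancel, rule Lim_null_comparison[OF eventuallyI d_lim])
      fix k
      have gk: "g k \<in> borel_measurable unit_interval"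
        "integrable unit_interval (\<lambda>t. (cmod (g k t))\<^sup>2)" "integrable unit_interval (g k)"
        using model_measurable[OF expansion_in g] model_square_integrable[OF expansion_in g]
          model_integrable[OF expansion_in g] by auto
      have sq: "integrable unit_interval (\<lambda>t. (cmod (f t - g k t))\<^sup>2)"
        using f gk by (intro integrable_square_diff) auto
      have int_\<chi>: "integrable unit_interval (\<lambda>t. ?\<chi> t * h t)" if "integrable unit_interval h" for h
        using integrable_mult_indicator[OF S that] by (simp add: scaleR_conv_of_real)
      have le: "(cmod (?\<chi> t * (f t - g k t)))\<^sup>2 \<le> (cmod (f t - g k t))\<^sup>2" for t
        by (simp add: indicator_def)
      have m: "(\<lambda>t. ?\<chi> t * (f t - g k t)) \<in> borel_measurable unit_interval"
        using S f gk by measurable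
      have sq': "integrable unit_interval (\<lambda>t. (cmod (?\<chi> t * (f t - g k t)))\<^sup>2)"
        using m le by (intro Bochner_Integration.integrable_bound[OF sq]) auto
      have "(LINT t|unit_interval. ?\<chi> t * g k t) - (LINT t|unit_interval. ?\<chi> t * f t)
          = - (LINT t|unit_interval. ?\<chi> t * (f t - g k t))"
        using int_\<chi>[OF int_f] int_\<chi>[OF gk(3)] by (simp add: right_diff_distrib)
      then have "norm ((LINT t|unit_interval. ?\<chi> t * g k t) - (LINT t|unit_interval. ?\<chi> t * f t))
          = cmod (LINT t|unit_interval. ?\<chi> t * (f t - g k t))"
        by simp
      also have "\<dots> \<le> sqrt (LINT t|unit_interval. (cmod (?\<chi> t * (f t - g k t)))\<^sup>2)"
        using m sq' by (rule norm_integral_le_L2)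
      also have "\<dots> \<le> d k"
        unfolding d_def using integral_mono[OF sq' sq le] by simp
      finally show "norm ((LINT t|unit_interval. ?\<chi> t * g k t)
          - (LINT t|unit_interval. ?\<chi> t * f t)) \<le> d k" .
    qed
    moreover have "(LINT t|unit_interval. ?\<chi> t * g k t) = ip (?s k) p" for k
      using ip_model[OF expansion_in g p] by simp
    ultimately have "(\<lambda>k. ip (?s k) p) \<longlonglongrightarrow> (LINT t|unit_interval. ?\<chi> t * f t)"
      by simp
    then show ?thesis
      using ip_expansion_limit[OF x p(1)] LIMSEQ_unique by blast
  qed
  have "AE t in unit_interval. f t \<in> cball 0 (norm x)"
  proof (rule unit_interval.averaging_theorem[OF int_f])
    fix S assume S: "S \<in> sets unit_interval" and pos: "0 < measure unit_interval S"
    obtain p where p: "p \<in> N" "(\<lambda>t. of_real (indicat_real S t)) \<in> \<pi> p" "adj p = p" "p o\<^sub>L p = p"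
      and np: "(norm2 tr p)\<^sup>2 = measure unit_interval S"
      using model_indicator[OF S] by blast
    have "set_lebesgue_integral unit_interval S f = ip x p"
      using average[OF S p(1,2)] by (simp add: set_lebesgue_integral_def scaleR_conv_of_real)
    also have "ip x p = ip (x o\<^sub>L p) p"
      using ip_sandwich[OF p(1,3,4) x] p(3) by (simp add: ip_def compose_assoc)
    finally have "cmod (set_lebesgue_integral unit_interval S f) \<le> norm2 tr (x o\<^sub>L p) * norm2 tr p"
      using cauchy_schwarz[of "x o\<^sub>L p" p] x p(1) by (simp add: sub_in)
    also have "\<dots> \<le> norm x * norm2 tr p * norm2 tr p"
      using x p(1) by (intro mult_right_mono norm2_mult_left) (auto simp: sub_in)
    also have "\<dots> = norm x * measure unit_interval S"
      using np by (simp add: power2_eq_square)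
    finally show "(1 / measure unit_interval S) *\<^sub>R set_lebesgue_integral unit_interval S f
        \<in> cball 0 (norm x)"
      using pos by (simp add: field_simps)
  qed simp
  then have bounded: "AE t in unit_interval. cmod (f t) \<le> norm x"
    by simp
  obtain a where a: "a \<in> N" "f \<in> \<pi> a"
    using model_surj[OF f(1) bounded] by blast
  \<comment> \<open>The limit \<open>f\<close> is represented by \<open>a\<close>, so its distance to \<open>a\<close> is \<open>0\<close>.\<close>
  have lim_a: "(\<lambda>k. norm2 tr (?s k - a)) \<longlonglongrightarrow> 0"
    using lim[OF a] by simp
  show thesis
  proof (rule that[OF a(1)])
    fix b assume b: "b \<in> N"
    have "(\<lambda>k. ip (?s k) b) \<longlonglongrightarrow> ip a b"
    proof (rule LIM_zero_cancel, rule Lim_null_comparison[OF eventuallyI])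
      show "norm (ip (?s k) b - ip a b) \<le> norm2 tr (?s k - a) * norm2 tr b" for k
        using cauchy_schwarz[of "?s k - a" b] a b by (simp add: ip_diff_left sub_in)
      show "(\<lambda>k. norm2 tr (?s k - a) * norm2 tr b) \<longlonglongrightarrow> 0"
        using tendsto_mult_right[OF lim_a, of "norm2 tr b"] by simp
    qed
    then show "ip a b = ip x b"
      using ip_expansion_limit[OF x b] LIMSEQ_unique by blast
  qed
qed

text \<open>The function of the projection of a positive element has nonnegative averages, so it is
  nonnegative, and the preimage of its square root exhibits the projection as \<open>b\<^sup>* b\<close>.\<close>

lemma projection_nonneg:
  assumes x: "x \<in> M" "op_nonneg x" and a: "a \<in> N" and ip: "\<And>b. b \<in> N \<Longrightarrow> ip a b = ip x b"
  shows "op_nonneg a"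
proof -
  obtain f where f: "f \<in> \<pi> a"
    using model_ex[OF a] by blast
  have closed: "closed (\<real>\<^sub>\<ge>\<^sub>0 :: complex set)"
    by (rule closed_nonneg_Reals_complex)
  have "AE t in unit_interval. f t \<in> \<real>\<^sub>\<ge>\<^sub>0"
  proof (rule unit_interval.averaging_theorem[OF model_integrable[OF a f] closed])
    fix S assume S: "S \<in> sets unit_interval" and pos: "0 < measure unit_interval S"
    obtain p where p: "p \<in> N" "(\<lambda>t. of_real (indicat_real S t)) \<in> \<pi> p" "adj p = p" "p o\<^sub>L p = p"
      using model_indicator[OF S] by blast
    have "set_lebesgue_integral unit_interval S f = ip a p"
      using ip_model[OF a f p(1,2)] by (simp add: set_lebesgue_integral_def scaleR_conv_of_real)
    also have "\<dots> = tr (adj p o\<^sub>L x o\<^sub>L p)"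
      using ip[OF p(1)] ip_sandwich[OF p(1,3,4) x(1)] by simp
    also have "\<dots> \<in> \<real>\<^sub>\<ge>\<^sub>0"
      using x p(1) by (intro tr_nonneg op_nonneg_sandwich) (auto simp: bounded_op sub_in)
    finally show "(1 / measure unit_interval S) *\<^sub>R set_lebesgue_integral unit_interval S f \<in> \<real>\<^sub>\<ge>\<^sub>0"
      using pos by (simp add: complex_nonneg_Reals_iff)
  qed
  then have nonneg: "AE t in unit_interval. 0 \<le> Re (f t) \<and> Im (f t) = 0"
    by eventually_elim (simp add: complex_nonneg_Reals_iff)
  have fm [measurable]: "f \<in> borel_measurable unit_interval"
    using a f by (rule model_measurable)
  obtain C where C: "AE t in unit_interval. cmod (f t) \<le> C"
    using model_bounded[OF a f] by blast
  then have bounded: "AE t in unit_interval. cmod (complex_of_real (sqrt (Re (f t)))) \<le> sqrt C"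
    using nonneg
  proof eventually_elim
    case (elim t)
    then show ?case
      using complex_Re_le_cmod[of "f t"] by simp
  qed
  have sqrt_m: "(\<lambda>t. complex_of_real (sqrt (Re (f t)))) \<in> borel_measurable unit_interval"
    by measurable
  obtain b where b: "b \<in> N" "(\<lambda>t. complex_of_real (sqrt (Re (f t)))) \<in> \<pi> b"
    by (rule model_surj[OF sqrt_m bounded])
  have bb: "adj b o\<^sub>L b \<in> N"
    by (intro star_subalgebra_compose[OF sub] star_subalgebra_adj[OF sub] b(1))
  have "AE t in unit_interval.
      cnj (complex_of_real (sqrt (Re (f t)))) * complex_of_real (sqrt (Re (f t))) = f t"
    using nonneg by eventually_elim (simp add: complex_eq_iff)
  then have "f \<in> \<pi> (adj b o\<^sub>L b)"
    by (rule model_cong[OF bb model_mult[OF star_subalgebra_adj[OF sub b(1)] model_adj[OF b] b] fm])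
  then have "a = adj b o\<^sub>L b"
    by (rule model_inj[OF a bb f])
  then show ?thesis
    using b by (simp add: op_nonneg_adj_compose bounded_op sub_in)
qed

lemma ex_cond_expectation:
  obtains E where "cond_expectation M tr N E"
proof -
  define E where "E x = (SOME a. a \<in> N \<and> (\<forall>b\<in>N. ip a b = ip x b))" for x
  have E: "E x \<in> N \<and> (\<forall>b\<in>N. ip (E x) b = ip x b)" if "x \<in> M" for x
  proof -
    have "\<exists>a. a \<in> N \<and> (\<forall>b\<in>N. ip a b = ip x b)"
      by (rule ex_projection[OF that]) blast
    then show ?thesis
      unfolding E_def by (rule someI_ex)
  qed
  then have E_in: "x \<in> M \<Longrightarrow> E x \<in> N" and ip_E: "x \<in> M \<Longrightarrow> b \<in> N \<Longrightarrow> ip (E x) b = ip x b" for x b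
    by simp_all
  note sub_closed = star_subalgebra_add[OF sub] star_subalgebra_diff[OF sub]
    star_subalgebra_scaleC[OF sub] star_subalgebra_compose[OF sub] star_subalgebra_adj[OF sub]
  have unique: "a = a'" if "a \<in> N" "a' \<in> N" "\<And>b. b \<in> N \<Longrightarrow> ip a b = ip a' b" for a a'
  proof -
    have "ip (a - a') (a - a') = 0"
      using that sub_closed(2)[of a a'] by (subst ip_diff_left) (simp_all add: sub_in)
    then have "a - a' = 0"
      using that by (intro norm2_eq_0) (simp_all add: ip_self sub_in)
    then show ?thesis by simp
  qed
  have "is_cond_exp M tr N E"
    unfolding is_cond_exp_def
  proof (intro conjI ballI allI impI)
    show "E x \<in> N" if "x \<in> M" for x
      using that by (rule E_in)
    show "E (x + y) = E x + E y" if "x \<in> M" "y \<in> M" for x y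
      using that by (intro unique) (simp_all add: E_in sub_closed ip_E ip_add_left sub_in)
    show "E (c *\<^sub>C x) = c *\<^sub>C E x" if "x \<in> M" for c x
      using that by (intro unique) (simp_all add: E_in sub_closed ip_E ip_scaleC_left sub_in)
    show "op_nonneg (E x)" if "x \<in> M" "op_nonneg x" for x
      using that E_in ip_E by (auto intro: projection_nonneg[of x "E x"])
    show "E a = a" if "a \<in> N" for a
      using that by (intro unique) (simp_all add: E_in ip_E sub_in)
    show "E (a o\<^sub>L x o\<^sub>L b) = a o\<^sub>L E x o\<^sub>L b" if "a \<in> N" "b \<in> N" "x \<in> M" for a b x
    proof (rule unique)
      have move: "ip (a o\<^sub>L y o\<^sub>L b) c = ip y (adj a o\<^sub>L (c o\<^sub>L adj b))" if "y \<in> M" "c \<in> N" for y c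
        using that \<open>a \<in> N\<close> \<open>b \<in> N\<close> ip_mult_right[of b "a o\<^sub>L y" c] ip_mult_left[of a y "c o\<^sub>L adj b"]
        by (simp add: sub_in)
      show "ip (E (a o\<^sub>L x o\<^sub>L b)) c = ip (a o\<^sub>L E x o\<^sub>L b) c" if "c \<in> N" for c
        using that \<open>a \<in> N\<close> \<open>b \<in> N\<close> \<open>x \<in> M\<close>
        by (simp add: ip_E move E_in sub_in sub_closed)
    qed (use that in \<open>simp_all add: E_in sub_closed sub_in\<close>)
    show "tr (E x) = tr x" if "x \<in> M" for x
      using ip_E[OF that id_sub] by (simp add: ip_def)
  qed
  then have "cond_expectation M tr N E"
    using sub id_sub by unfold_locales
  then show thesis
    by (rule that)
qed

end

section \<open>A Haar unitary\<close>

lemma integral_cis: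
  assumes "m \<noteq> (0::int)"
  shows "(LINT t|unit_interval. cis (2 * pi * of_int m * t)) = 0"
proof -
  define c where "c = 2 * pi * \<i> * of_int m"
  have c: "c \<noteq> 0"
    using assms by (simp add: c_def)
  have cis_eq: "cis (2 * pi * of_int m * t) = exp (c * of_real t)" for t
    by (simp add: cis_conv_exp c_def algebra_simps)
  have "((\<lambda>t. exp (c * of_real t)) has_integral
      exp (c * of_real 1) / c - exp (c * of_real 0) / c) {0..1::real}"
  proof (rule fundamental_theorem_of_calculus)
    fix t :: real
    have "((\<lambda>z. exp (c * z) / c) has_field_derivative exp (c * of_real t)) (at (of_real t))"
      using c by (auto intro!: derivative_eq_intros)
    then show "((\<lambda>t. exp (c * of_real t) / c) has_vector_derivative exp (c * of_real t))
        (at t within {0..1})"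
      by (rule has_vector_derivative_real_field)
  qed simp
  moreover have "exp (c * of_real 1) = 1"
    using cis_eq[of 1] by (simp add: cis_multiple_2pi)
  ultimately have "((\<lambda>t. cis (2 * pi * of_int m * t)) has_integral 0) {0..1}"
    by (simp add: cis_eq)
  moreover have "integrable unit_interval (\<lambda>t. cis (2 * pi * of_int m * t))"
    by (intro continuous_imp_integrable_real continuous_intros)
  ultimately show ?thesis
    by (simp add: lebesgue_integral_eq_integral integral_unique)
qed

text \<open>The preimage of \<open>e\<^bsup>2\<pi>it\<^esup>\<close>, whose powers are the trigonometric orthonormal system.\<close>

lemma (in Linf_model) haar_unitary:
  obtains u where "u \<in> N" "unitary u" "\<And>j. unitary_pow u j \<in> N"
    "\<And>i j. ip (unitary_pow u i) (unitary_pow u j) = (if i = j then 1 else 0)"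
proof -
  let ?f = "\<lambda>j::int. \<lambda>t::real. cis (2 * pi * of_int j * t)"
  have f_mult: "(\<lambda>t. ?f i t * ?f j t) = ?f (i + j)" for i j
    by (simp add: cis_mult algebra_simps)
  have f_cnj: "(\<lambda>t. cnj (?f j t)) = ?f (- j)" for j
    by (simp add: cis_cnj)
  have "?f 1 \<in> borel_measurable unit_interval"
    by (intro continuous_imp_measurable_on_sets_lebesgue continuous_intros) simp
  then obtain u where u: "u \<in> N" "?f 1 \<in> \<pi> u"
    by (rule model_surj[of _ 1]) auto
  have adj_u: "adj u \<in> N" "?f (- 1) \<in> \<pi> (adj u)"
    using model_adj[OF u] f_cnj[of 1] star_subalgebra_adj[OF sub u(1)] by simp_all
  have one: "?f 0 \<in> \<pi> id_blinfun"
    using model_one by simp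
  have pow: "op_pow w n \<in> N \<and> ?f (m * int n) \<in> \<pi> (op_pow w n)"
    if w: "w \<in> N" "?f m \<in> \<pi> w" for w m n
  proof (induction n)
    case 0
    then show ?case using one id_sub by simp
  next
    case (Suc n)
    then have "(\<lambda>t. ?f m t * ?f (m * int n) t) \<in> \<pi> (w o\<^sub>L op_pow w n)"
      by (intro model_mult w) auto
    then show ?case
      using Suc w star_subalgebra_compose[OF sub] unfolding f_mult by (simp add: algebra_simps)
  qed
  have upow: "unitary_pow u j \<in> N \<and> ?f j \<in> \<pi> (unitary_pow u j)" for j
  proof (cases "0 \<le> j")
    case True
    then show ?thesis
      using pow[OF u, of "nat j"] by (simp add: unitary_pow_def)
  next
    case False
    then show ?thesis
      using pow[OF adj_u, of "nat (- j)"] by (simp add: unitary_pow_def)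
  qed
  have "unitary u"
    unfolding unitary_def
  proof
    have "?f 0 \<in> \<pi> (adj u o\<^sub>L u)"
      using model_mult[OF adj_u u] f_mult[of "- 1" 1] by simp
    then show "adj u o\<^sub>L u = id_blinfun"
      by (rule model_inj[OF star_subalgebra_compose[OF sub adj_u(1) u(1)] id_sub _ one])
    have "?f 0 \<in> \<pi> (u o\<^sub>L adj u)"
      using model_mult[OF u adj_u] f_mult[of 1 "- 1"] by simp
    then show "u o\<^sub>L adj u = id_blinfun"
      by (rule model_inj[OF star_subalgebra_compose[OF sub u(1) adj_u(1)] id_sub _ one])
  qed
  moreover have "ip (unitary_pow u i) (unitary_pow u j) = (if i = j then 1 else 0)" for i j
  proof -
    have "ip (unitary_pow u i) (unitary_pow u j) = (LINT t|unit_interval. cnj (?f j t) * ?f i t)"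
      using upow by (intro ip_model) auto
    also have "(\<lambda>t. cnj (?f j t) * ?f i t) = ?f (i - j)"
      using f_mult[of "- j" i] by (simp add: cis_cnj)
    finally show ?thesis
      using integral_cis[of "i - j"] by (simp add: measure_unit_interval)
  qed
  ultimately show thesis
    using that u upow by blast
qed

section \<open>Hilbert--Schmidt operators on orthonormal families\<close>

context traced_algebra
begin

text \<open>By Bessel's inequality at most \<open>\<parallel>x\<parallel>\<^sub>2\<^sup>2 / \<delta>\<^sup>2\<close> members of an orthonormal family have an inner
  product with \<open>x\<close> of modulus at least \<open>\<delta>\<close>.\<close>

lemma bessel_tendsto_0:
  fixes e :: "'i \<Rightarrow> 'h op"
  assumes e: "\<And>i. e i \<in> M" and orth: "\<And>i j. ip (e i) (e j) = (if i = j then 1 else 0)"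
    and x: "x \<in> M"
  shows "((\<lambda>i. cmod (ip (e i) x)) \<longlongrightarrow> 0) cofinite"
proof (rule tendstoI)
  fix \<delta> :: real
  assume \<delta>: "0 < \<delta>"
  let ?B = "{i. \<delta> \<le> cmod (ip (e i) x)}"
  have "finite ?B"
  proof (rule finite_if_finite_subsets_card_bdd[THEN conjunct1])
    fix F assume F: "F \<subseteq> ?B" "finite F"
    have "real (card F) * \<delta>\<^sup>2 \<le> (\<Sum>i\<in>F. (cmod (ip x (e i)))\<^sup>2)"
    proof (rule order_trans[OF _ sum_mono])
      show "real (card F) * \<delta>\<^sup>2 \<le> (\<Sum>i\<in>F. \<delta>\<^sup>2)"
        by simp
      show "\<delta>\<^sup>2 \<le> (cmod (ip x (e i)))\<^sup>2" if "i \<in> F" for i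
        using that F \<delta> ip_commute[OF e x, of i] by (intro power_mono) auto
    qed
    also have "\<dots> \<le> (norm2 tr x)\<^sup>2"
      using F e orth x by (intro bessel) auto
    finally have "real (card F) \<le> (norm2 tr x)\<^sup>2 / \<delta>\<^sup>2"
      using \<delta> by (simp add: pos_le_divide_eq)
    then show "card F \<le> nat \<lceil>(norm2 tr x)\<^sup>2 / \<delta>\<^sup>2\<rceil>"
      by linarith
  qed
  moreover have "{i. \<not> dist (cmod (ip (e i) x)) 0 < \<delta>} = ?B"
    by auto
  ultimately show "\<forall>\<^sub>F i in cofinite. dist (cmod (ip (e i) x)) 0 < \<delta>"
    by (simp only: eventually_cofinite)
qed

text \<open>The bound by the 2-norm is uniform in \<open>i\<close>, so convergence on a 2-norm dense span passes to
  all of \<open>M\<close>. It is applied to each variable of a bilinear expression in turn.\<close>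

lemma tendsto_0_of_dense:
  fixes G :: "'h op \<Rightarrow> 'i \<Rightarrow> 'h op"
  assumes Y: "Y \<subseteq> M" "L2_dense M tr (complex_vector.span Y)"
    and G_in: "\<And>x i. x \<in> M \<Longrightarrow> G x i \<in> M"
    and G_add: "\<And>x y i. x \<in> M \<Longrightarrow> y \<in> M \<Longrightarrow> G (x + y) i = G x i + G y i"
    and G_scaleC: "\<And>c x i. x \<in> M \<Longrightarrow> G (c *\<^sub>C x) i = c *\<^sub>C G x i"
    and G_bound: "\<And>x i. x \<in> M \<Longrightarrow> norm2 tr (G x i) \<le> C * norm2 tr x"
    and G_lim: "\<And>y. y \<in> Y \<Longrightarrow> ((\<lambda>i. norm2 tr (G y i)) \<longlongrightarrow> 0) F"
    and x: "x \<in> M"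
  shows "((\<lambda>i. norm2 tr (G x i)) \<longlongrightarrow> 0) F"
proof (rule tendstoI)
  fix e :: real
  assume e: "0 < e"
  have span: "z \<in> M \<and> ((\<lambda>i. norm2 tr (G z i)) \<longlongrightarrow> 0) F" if "z \<in> complex_vector.span Y" for z
    using that
  proof (induction rule: complex_vector.span_induct_alt)
    case base
    have "norm2 tr (G 0 i) = 0" for i
      using G_bound[of 0 i] norm2_nonneg[OF G_in[of 0 i]] by simp
    then show ?case by simp
  next
    case (step c x y)
    then have xy: "x \<in> M" "y \<in> M"
      using Y by auto
    have "((\<lambda>i. cmod c * norm2 tr (G x i) + norm2 tr (G y i)) \<longlongrightarrow> cmod c * 0 + 0) F"
      using step G_lim by (intro tendsto_intros) auto
    then have lim: "((\<lambda>i. cmod c * norm2 tr (G x i) + norm2 tr (G y i)) \<longlongrightarrow> 0) F"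
      by simp
    have "norm (norm2 tr (G (c *\<^sub>C x + y) i)) \<le> cmod c * norm2 tr (G x i) + norm2 tr (G y i)" for i
      using norm2_triangle[of "c *\<^sub>C G x i" "G y i"] xy
      by (simp add: G_add G_scaleC G_in norm2_scaleC)
    then have "((\<lambda>i. norm2 tr (G (c *\<^sub>C x + y) i)) \<longlongrightarrow> 0) F"
      by (rule Lim_null_comparison[OF eventuallyI lim])
    then show ?case
      using xy by simp
  qed
  \<comment> \<open>A positive constant, so that \<open>e\<close> can be divided by it.\<close>
  define C' where "C' = max C 1"
  have C': "C' > 0" "\<And>x i. x \<in> M \<Longrightarrow> norm2 tr (G x i) \<le> C' * norm2 tr x"
  proof -
    show "C' > 0" by (simp add: C'_def)
    show "norm2 tr (G x i) \<le> C' * norm2 tr x" if "x \<in> M" for x i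
      using G_bound[OF that, of i] mult_right_mono[of C C' "norm2 tr x"] that
      by (simp add: C'_def)
  qed
  have "0 < e / (2 * C')"
    using e C' by simp
  then obtain z where z: "z \<in> complex_vector.span Y" "norm2 tr (x - z) < e / (2 * C')"
    by (rule L2_denseD[OF Y(2) order_refl x])
  have zM: "z \<in> M" and z_lim: "((\<lambda>i. norm2 tr (G z i)) \<longlongrightarrow> 0) F"
    using span[OF z(1)] by auto
  have "\<forall>\<^sub>F i in F. dist (norm2 tr (G z i)) 0 < e / 2"
    by (rule tendstoD[OF z_lim]) (use e in simp)
  then show "\<forall>\<^sub>F i in F. dist (norm2 tr (G x i)) 0 < e"
  proof eventually_elim
    case (elim i)
    have "norm2 tr (G x i) \<le> norm2 tr (G (x - z) i) + norm2 tr (G z i)"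
      using G_add[of "x - z" z i] norm2_triangle[of "G (x - z) i" "G z i"] x zM by (simp add: G_in)
    also have "norm2 tr (G (x - z) i) \<le> C' * norm2 tr (x - z)"
      using x zM by (intro C') auto
    also have "\<dots> < e / 2"
      using z(2) C'(1) by (simp add: field_simps)
    finally show ?case
      using elim x by (simp add: G_in)
  qed
qed

end

text \<open>Splitting the expansion of \<open>a\<close> after \<open>K\<close> terms, the Cauchy--Schwarz inequality bounds the tail
  of \<open>T a\<close> by \<open>\<parallel>a\<parallel>\<^sub>2\<close> times the tail of the Hilbert--Schmidt sum. The finitely many other
  coefficients of the members \<open>e\<^sub>i\<close> of an orthonormal family tend to \<open>0\<close> by Bessel's inequality.\<close>

lemma (in L2_basis) hilbert_schmidt_tendsto_0:
  fixes e :: "'i \<Rightarrow> 'a op"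
  assumes T_in: "\<And>a. a \<in> N \<Longrightarrow> T a \<in> M"
    and T_add: "\<And>a b. a \<in> N \<Longrightarrow> b \<in> N \<Longrightarrow> T (a + b) = T a + T b"
    and T_scaleC: "\<And>c a. a \<in> N \<Longrightarrow> T (c *\<^sub>C a) = c *\<^sub>C T a"
    and T_bound: "\<And>a. a \<in> N \<Longrightarrow> norm2 tr (T a) \<le> C * norm2 tr a"
    and HS: "summable (\<lambda>n. (norm2 tr (T (v n)))\<^sup>2)"
    and e: "\<And>i. e i \<in> N" and orth: "\<And>i j. ip (e i) (e j) = (if i = j then 1 else 0)"
  shows "((\<lambda>i. norm2 tr (T (e i))) \<longlongrightarrow> 0) cofinite"
proof (rule tendstoI)
  fix r :: real
  assume r: "0 < r"
  define t where "t n = norm2 tr (T (v n))" for n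
  have t_nonneg: "0 \<le> t n" for n
    by (simp add: t_def T_in v_in)
  have T_expansion: "T (expansion k a) = (\<Sum>n<k. ip a (v n) *\<^sub>C T (v n))" for k a
  proof (induction k)
    case 0
    have "T 0 = 0"
      using T_add[of 0 0] star_subalgebra_zero[OF sub] by simp
    then show ?case by (simp add: expansion_def)
  next
    case (Suc k)
    have "T (expansion (Suc k) a) = T (expansion k a + ip a (v k) *\<^sub>C v k)"
      by (simp add: expansion_def)
    also have "\<dots> = T (expansion k a) + ip a (v k) *\<^sub>C T (v k)"
      by (simp add: T_add T_scaleC expansion_in v_in star_subalgebra_scaleC[OF sub])
    finally show ?case
      using Suc by simp
  qed
  have "0 < (r / 2)\<^sup>2"
    using r by simp
  then obtain K where K: "\<And>m n. K \<le> m \<Longrightarrow> norm (\<Sum>i\<in>{m..<n}. (t i)\<^sup>2) < (r / 2)\<^sup>2"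
    using HS unfolding summable_Cauchy t_def[symmetric] by meson
  have main: "norm2 tr (T a) \<le> (\<Sum>n<K. cmod (ip a (v n)) * t n) + norm2 tr a * (r / 2)"
    if a: "a \<in> N" for a
  proof -
    let ?c = "\<lambda>n. cmod (ip a (v n))"
    let ?R = "(\<Sum>n<K. ?c n * t n) + norm2 tr a * (r / 2)"
    have aM: "a \<in> M" using a by (rule sub_in)
    have part: "norm2 tr (T (expansion k a)) \<le> ?R" if k: "K \<le> k" for k
    proof -
      have "norm2 tr (T (expansion k a)) \<le> (\<Sum>n<k. ?c n * t n)"
        unfolding T_expansion
        using norm2_sum_le[of "{..<k}" "\<lambda>n. ip a (v n) *\<^sub>C T (v n)"]
        by (simp add: norm2_scaleC T_in v_in t_def)
      also have "\<dots> = (\<Sum>n<K. ?c n * t n) + (\<Sum>n\<in>{K..<k}. ?c n * t n)"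
        using sum.atLeastLessThan_concat[of 0 K k "\<lambda>n. ?c n * t n"] k by (simp add: lessThan_atLeast0)
      also have "(\<Sum>n\<in>{K..<k}. ?c n * t n) \<le> L2_set ?c {K..<k} * L2_set t {K..<k}"
        using L2_set_mult_ineq[of ?c t "{K..<k}"] t_nonneg by simp
      also have "\<dots> \<le> norm2 tr a * (r / 2)"
      proof (rule mult_mono)
        show "L2_set ?c {K..<k} \<le> norm2 tr a"
          unfolding L2_set_def
          by (rule real_le_lsqrt) (use aM bessel[of "{K..<k}" v a] in \<open>simp_all add: v_orth sum_nonneg\<close>)
        show "L2_set t {K..<k} \<le> r / 2"
          unfolding L2_set_def
          by (rule real_le_lsqrt) (use r K[of K k] in \<open>simp_all add: sum_nonneg\<close>)
      qed (use aM in \<open>simp_all add: L2_set_nonneg\<close>)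
      finally show ?thesis by simp
    qed
    have "norm2 tr (T a) \<le> ?R + C * norm2 tr (a - expansion k a)" if k: "K \<le> k" for k
    proof -
      have d: "a - expansion k a \<in> N"
        by (rule star_subalgebra_diff[OF sub a expansion_in])
      have "norm2 tr (T a) \<le> norm2 tr (T (expansion k a)) + norm2 tr (T (a - expansion k a))"
        using T_add[OF expansion_in d, of k a]
          norm2_triangle[OF T_in[OF expansion_in] T_in[OF d], of k a] by simp
      then show ?thesis
        using part[OF k] T_bound[OF d] by simp
    qed
    moreover have "(\<lambda>k. ?R + C * norm2 tr (a - expansion k a)) \<longlonglongrightarrow> ?R + C * 0"
      by (intro tendsto_intros expansion_limit a)
    ultimately have "norm2 tr (T a) \<le> ?R + C * 0"
      by (intro LIMSEQ_le_const) blast+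
    then show ?thesis by simp
  qed
  have "((\<lambda>i. \<Sum>n<K. cmod (ip (e i) (v n)) * t n) \<longlongrightarrow> (\<Sum>n<K. 0 * t n)) cofinite"
    by (intro tendsto_sum tendsto_mult tendsto_const bessel_tendsto_0) (simp_all add: e sub_in orth)
  then have lim: "((\<lambda>i. \<Sum>n<K. cmod (ip (e i) (v n)) * t n) \<longlongrightarrow> 0) cofinite"
    by simp
  have "\<forall>\<^sub>F i in cofinite. dist (\<Sum>n<K. cmod (ip (e i) (v n)) * t n) 0 < r / 2"
    by (rule tendstoD[OF lim]) (use r in simp)
  then show "\<forall>\<^sub>F i in cofinite. dist (norm2 tr (T (e i))) 0 < r"
  proof eventually_elim
    case (elim i)
    have "(norm2 tr (e i))\<^sup>2 = 1"
      using norm2_power2[of "e i"] e by (simp add: orth sub_in)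
    then have "norm2 tr (e i) = 1"
      using norm2_nonneg[OF sub_in[OF e], of i] by (auto simp: power2_eq_1_iff)
    then have "norm2 tr (T (e i)) \<le> (\<Sum>n<K. cmod (ip (e i) (v n)) * t n) + r / 2"
      using main[OF e, of i] by simp
    then show ?case
      using elim norm2_nonneg[OF T_in[OF e]] by (simp add: abs_less_iff)
  qed
qed

section \<open>From square summability to asymptotic multiplicativity\<close>

lemma filtercomap_abs_le_cofinite: "filtercomap (\<lambda>j::int. \<bar>j\<bar>) at_top \<le> cofinite"
proof (rule filter_leI)
  fix P :: "int \<Rightarrow> bool"
  assume "eventually P cofinite"
  then have "finite {j. \<not> P j}"
    by (simp add: eventually_cofinite)
  then obtain B where B: "abs ` {j. \<not> P j} \<subseteq> {..B}"
    unfolding finite_int_iff_bounded_le by blast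
  then have "\<bar>j\<bar> > B \<Longrightarrow> P j" for j
    by force
  then show "eventually P (filtercomap (\<lambda>j::int. \<bar>j\<bar>) at_top)"
    unfolding eventually_filtercomap
    by (intro exI[of _ "\<lambda>n. n > B"]) (simp add: eventually_gt_at_top)
qed

theorem theorem3p1:
  fixes M A Y :: "'h::complex_hilbert op set"
    and tr :: "'h op \<Rightarrow> complex"
    and \<pi> :: "'h op \<Rightarrow> (real \<Rightarrow> complex) set"
    and v :: "nat \<Rightarrow> 'h op"
  assumes "type_II1_factor M" and "normalized_trace M tr"
    and "von_neumann_subalgebra A M" and "abelian A"
    and "star_isomorphism_Linf A \<pi>" and "induces_L2_isometry A tr \<pi>"
    and "\<And>n. v n \<in> A" and "L2_orthonormal_basis A tr v"
    and "Y \<subseteq> M" and "L2_dense M tr (complex_vector.span Y)"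
    and "\<And>x y. x \<in> Y \<Longrightarrow> y \<in> Y \<Longrightarrow>
      summable (\<lambda>n. (norm2 tr (cond_exp M tr A (x o\<^sub>L v n o\<^sub>L y)
        - (cond_exp M tr A x o\<^sub>L cond_exp M tr A y o\<^sub>L v n)))\<^sup>2)"
  shows "asymptotic_homomorphism M tr A \<and> strongly_singular_masa M tr A \<and> popa_delta_one M tr A"
proof -
  have vN: "von_neumann_algebra M" "von_neumann_algebra A" "A \<subseteq> M"
    using assms(1,3) by (auto simp: type_II1_factor_def factor_def von_neumann_subalgebra_def)
  have stars: "star_subalgebra M bounded_ops" "star_subalgebra A M"
    using vN by (auto simp: von_neumann_algebra_def star_subalgebra_def)
  have ids: "id_blinfun \<in> M" "id_blinfun \<in> A"
    using vN by (auto intro: von_neumann_algebra_id)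
  interpret traced_algebra M tr
    by unfold_locales (fact stars ids assms)+
  interpret model: Linf_model M tr A v \<pi>
    by unfold_locales (fact stars ids assms)+
  obtain E where "cond_expectation M tr A E"
    by (rule model.ex_cond_expectation)
  then interpret cond_expectation M tr A E .
  interpret abelian_expectation M tr A E
    by unfold_locales (use assms(4) in \<open>auto simp: abelian_def\<close>)
  obtain u where u: "u \<in> A" "unitary u" and u_pow: "\<And>j. unitary_pow u j \<in> A"
    and orth: "\<And>i j. ip (unitary_pow u i) (unitary_pow u j) = (if i = j then 1 else 0)"
    by (rule model.haar_unitary) blast
  have u_pow_M: "unitary_pow u j \<in> M" and u_pow_unitary: "unitary (unitary_pow u j)" for j
    using u u_pow by (auto simp: sub_in unitary_unitary_pow)
  \<comment> \<open>The defect of multiplicativity, a Hilbert--Schmidt operator in \<open>a\<close> when \<open>x, y \<in> Y\<close>.\<close>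
  define T where "T x y a = E (x o\<^sub>L a o\<^sub>L y) - (E x o\<^sub>L E y o\<^sub>L a)" for x y a
  have T_in: "T x y a \<in> M" if "x \<in> M" "y \<in> M" "a \<in> M" for x y a
    using that by (simp add: T_def)
  have T_le: "norm2 tr (T x y a) \<le> norm2 tr (x o\<^sub>L a o\<^sub>L y) + norm2 tr (E x o\<^sub>L E y o\<^sub>L a)"
    if "x \<in> M" "y \<in> M" "a \<in> M" for x y a
    using norm2_triangle_diff[of "E (x o\<^sub>L a o\<^sub>L y)" "E x o\<^sub>L E y o\<^sub>L a"]
      norm2_E_le[of "x o\<^sub>L a o\<^sub>L y"] that by (simp add: T_def)
  have on_Y: "((\<lambda>j. norm2 tr (T x y (unitary_pow u j))) \<longlongrightarrow> 0) cofinite" if "x \<in> Y" "y \<in> Y" for x y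
  proof (rule model.hilbert_schmidt_tendsto_0[where T = "T x y" and e = "unitary_pow u"
        and C = "norm y * norm x + norm (E x o\<^sub>L E y)"])
    have xy: "x \<in> M" "y \<in> M"
      using that assms(9) by auto
    show "T x y a \<in> M" if "a \<in> A" for a
      using that xy by (simp add: T_in sub_in)
    show "T x y (a + b) = T x y a + T x y b" if "a \<in> A" "b \<in> A" for a b
      using that xy by (simp add: T_def compose_add_left compose_add_right E_add sub_in)
    show "T x y (c *\<^sub>C a) = c *\<^sub>C T x y a" if "a \<in> A" for c a
      using that xy by (simp add: T_def E_scaleC sub_in complex_vector.scale_right_diff_distrib)
    show "norm2 tr (T x y a) \<le> (norm y * norm x + norm (E x o\<^sub>L E y)) * norm2 tr a" if "a \<in> A" for a
    proof -
      have a: "a \<in> M" using that by (rule sub_in)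
      have "norm2 tr (x o\<^sub>L a o\<^sub>L y) \<le> norm y * norm2 tr (x o\<^sub>L a)"
        using a xy by (intro norm2_mult_right) auto
      also have "\<dots> \<le> norm y * (norm x * norm2 tr a)"
        using a xy by (intro mult_left_mono norm2_mult_left) auto
      finally show ?thesis
        using T_le[OF xy a] norm2_mult_left[of "E x o\<^sub>L E y" a] a xy by (simp add: algebra_simps)
    qed
    show "summable (\<lambda>n. (norm2 tr (T x y (v n)))\<^sup>2)"
      using assms(11)[OF that] xy assms(7) by (simp add: T_def cond_exp_eq sub_in)
  qed (fact u_pow orth)+
  \<comment> \<open>With \<open>y\<close> fixed the defect is bounded by the 2-norm of \<open>x\<close>, and conversely; the operator norm
    of the fixed variable enters the constant. So \<open>x\<close> and \<open>y\<close> are released one after the other.\<close>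
  have on_left: "((\<lambda>j. norm2 tr (T x y (unitary_pow u j))) \<longlongrightarrow> 0) cofinite" if "x \<in> M" "y \<in> Y" for x y
  proof (rule tendsto_0_of_dense[OF assms(9,10), where G = "\<lambda>x j. T x y (unitary_pow u j)"])
    have y: "y \<in> M"
      using that assms(9) by auto
    show "T x y (unitary_pow u j) \<in> M" if "x \<in> M" for x j
      using that y u_pow_M by (simp add: T_in)
    show "T (x + x') y (unitary_pow u j) = T x y (unitary_pow u j) + T x' y (unitary_pow u j)"
      if "x \<in> M" "x' \<in> M" for x x' j
      using that y u_pow_M by (simp add: T_def compose_add_left E_add)
    show "T (c *\<^sub>C x) y (unitary_pow u j) = c *\<^sub>C T x y (unitary_pow u j)" if "x \<in> M" for c x j
      using that y u_pow_M by (simp add: T_def E_scaleC complex_vector.scale_right_diff_distrib)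
    show "norm2 tr (T x y (unitary_pow u j)) \<le> (norm y + norm (E y)) * norm2 tr x"
      if x: "x \<in> M" for x j
    proof -
      have "norm2 tr (x o\<^sub>L unitary_pow u j o\<^sub>L y) \<le> norm y * norm2 tr x"
        using norm2_mult_right[of y "x o\<^sub>L unitary_pow u j"] x y u_pow_M u_pow_unitary
        by (simp add: norm2_unitary_right)
      moreover have "norm2 tr (E x o\<^sub>L E y o\<^sub>L unitary_pow u j) \<le> norm (E y) * norm2 tr x"
        using norm2_mult_right[of "E y" "E x"] mult_left_mono[OF norm2_E_le[OF x], of "norm (E y)"]
          x y u_pow_M u_pow_unitary by (simp add: norm2_unitary_right)
      ultimately show ?thesis
        using T_le[OF x y u_pow_M, of j] by (simp add: algebra_simps)
    qed
  qed (use on_Y that in auto)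
  have on_M: "((\<lambda>j. norm2 tr (T x y (unitary_pow u j))) \<longlongrightarrow> 0) cofinite" if x: "x \<in> M" "y \<in> M" for x y
  proof (rule tendsto_0_of_dense[OF assms(9,10), where G = "\<lambda>y j. T x y (unitary_pow u j)"])
    show "T x y (unitary_pow u j) \<in> M" if "y \<in> M" for y j
      using that x u_pow_M by (simp add: T_in)
    show "T x (y + y') (unitary_pow u j) = T x y (unitary_pow u j) + T x y' (unitary_pow u j)"
      if "y \<in> M" "y' \<in> M" for y y' j
      using that x u_pow_M by (simp add: T_def compose_add_left compose_add_right E_add)
    show "T x (c *\<^sub>C y) (unitary_pow u j) = c *\<^sub>C T x y (unitary_pow u j)" if "y \<in> M" for c y j
      using that x u_pow_M by (simp add: T_def E_scaleC complex_vector.scale_right_diff_distrib)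
    show "norm2 tr (T x y (unitary_pow u j)) \<le> (norm x + norm (E x)) * norm2 tr y"
      if y: "y \<in> M" for y j
    proof -
      have "norm2 tr (x o\<^sub>L unitary_pow u j o\<^sub>L y) \<le> norm x * norm2 tr y"
        using norm2_mult_left[of x "unitary_pow u j o\<^sub>L y"] x y u_pow_M u_pow_unitary
        by (simp add: norm2_unitary_left compose_assoc)
      moreover have "norm2 tr (E x o\<^sub>L E y o\<^sub>L unitary_pow u j) \<le> norm (E x) * norm2 tr y"
        using norm2_mult_left[of "E x" "E y"] mult_left_mono[OF norm2_E_le[OF y], of "norm (E x)"]
          x y u_pow_M u_pow_unitary by (simp add: norm2_unitary_right)
      ultimately show ?thesis
        using T_le[OF x(1) y u_pow_M, of j] by (simp add: algebra_simps)
    qed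
  qed (use on_left x in auto)
  have "asymptotic_homomorphism M tr A"
    unfolding asymptotic_homomorphism_def Let_def
  proof (intro bexI conjI ballI)
    fix x y assume xy: "x \<in> M" "y \<in> M"
    have "norm2 tr (cond_exp M tr A (x o\<^sub>L unitary_pow u j o\<^sub>L y)
        - (cond_exp M tr A x o\<^sub>L cond_exp M tr A y o\<^sub>L unitary_pow u j))
        = norm2 tr (T x y (unitary_pow u j))" for j
      using xy u_pow_M by (simp add: T_def cond_exp_eq)
    then show "((\<lambda>j. norm2 tr (cond_exp M tr A (x o\<^sub>L unitary_pow u j o\<^sub>L y)
        - (cond_exp M tr A x o\<^sub>L cond_exp M tr A y o\<^sub>L unitary_pow u j)))
        \<longlongrightarrow> 0) (filtercomap (\<lambda>j::int. \<bar>j\<bar>) at_top)"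
      using tendsto_mono[OF filtercomap_abs_le_cofinite on_M[OF xy]] by simp
  qed (fact u)+
  with asymptotic_homomorphism_imp show ?thesis
    by blast
qed

end
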